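(* Let $\pi$ be a group and let $\mathcal{T}$ be a (strict) balanced T-category over $\pi$. Then $\mathcal{N}(\mathcal{T})$ has a structure of balanced T-category (induced from $\mathcal{T}$). Moreover, $\mathcal{N}(\mathcal{T})$ is a ribbon T-category, and any other ribbon subcategory of $\mathcal{T}$ (i.e. any ribbon T-category included in $\mathcal{T}$, with the structure induced from $\mathcal{T}$) is included in $\mathcal{N}(\mathcal{T})$.
   Context: An object also denotes its identity arrow. **T-categories.** A T-category over $\pi$ is a tensor category $\mathcal{T}$ that is the disjoint union of subcategories $\{\mathcal{T}_\alpha\}_{\alpha\in\pi}$ (no arrows between different components) with $U\otimes V\in\mathcal{T}_{\alpha\beta}$ for $U\in\mathcal{T}_\alpha,V\in\mathcal{T}_\beta$, with a group homomorphism $\varphi:\pi\to\mathrm{aut}(\mathcal{T})$ (invertible strict tensor endofunctors) such that $\varphi_\beta(\mathcal{T}_\alpha)=\mathcal{T}_{\beta\alpha\beta^{-1}}$. For $V\in\mathcal{T}_\beta$ write ${}^V(\cdot)={}^\beta(\cdot)=\varphi_\beta$. **Duals.** A left dual of $U$ is $U^*$ with $b_U:\mathbb{I}\to U\otimes U^*$, $d_U:U^*\otimes U\to\mathbb{I}$ satisfying $(U\otimes d_U)(b_U\otimes U)=U$, $(d_U\otimes U^* )(U^*\otimes b_U)=U^*$. It is stable if, for $U\in\mathcal{T}_\alpha$ and every $\beta$ commuting with $\alpha$, $\varphi_\beta(U)=U$ implies $\varphi_\beta(b_U)=b_U$ and $\varphi_\beta(d_U)=d_U$; then, putting $\Phi(U)=\{\varphi_\beta(U)\}_{\beta\in\pi}$,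 every $V=\varphi_\beta(U)\in\Phi(U)$ gets the stable left dual $\varphi_\beta(U^* )$ with unit $\varphi_\beta(b_U)$ and counit $\varphi_\beta(d_U)$, independent of the choice of $\beta$. A left autonomous T-category is a T-category with a choice of left duals, $U^*\in\mathcal{T}_{\alpha^{-1}}$ for $U\in\mathcal{T}_\alpha$, with $\varphi_\beta(b_U)=b_{\varphi_\beta(U)}$, $\varphi_\beta(d_U)=d_{\varphi_\beta(U)}$. $f^*:V^*\to U^*$ denotes the dual of $f:U\to V$. **Braided, balanced, ribbon.** A braiding: isomorphisms $c_{U,V}:U\otimes V\to{}^UV\otimes U$ with $({}^\alpha g\otimes f)c_{U,V}=c_{U',V'}(f\otimes g)$ for $f\in\mathcal{T}_\alpha(U,U')$, $g\in\mathcal{T}(V,V')$; $c_{U\otimes V,W}=(c_{U,{}^VW}\otimes V)(U\otimes c_{V,W})$; $c_{U,V\otimes W}=({}^UV\otimes c_{U,W})(c_{U,V}\otimes W)$; $\varphi_\beta(c_{U,V})=c_{\varphi_\beta(U),\varphi_\beta(V)}$. A twist: isomorphisms $\theta_U:U\to{}^UU$ with $\theta_Vf=({}^\alpha f)\theta_U$ for $f\in\mathcal{T}_\alpha(U,V)$; $\theta_{U\otimes V}=c_{{}^{U\otimes V}V,{}^UU}\,c_{{}^UU,{}^VV}(\theta_U\otimes\theta_V)$; $\varphi_\alpha(\theta_U)=\theta_{\varphi_\alpha(U)}$. Balanced = braided with twist. Ribbon = balanced and left autonomous with $({}^UU\otimes\theta_{{}^UU^*})b_{{}^UU}=(\theta_U\otimes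 U^* )b_U$, where ${}^UU^*=\varphi_\alpha(U^* )$ for $U\in\mathcal{T}_\alpha$. **Good duals and $\mathcal{N}(\mathcal{T})$.** For $U\in\mathcal{T}_\alpha$ with a stable left dual, $$\omega_U=(d_{{}^{\alpha^2}U}\otimes U)\circ\bigl({}^{\alpha^2}U^*\otimes(c_{{}^{\alpha^2}U,U})^{-1}\bigr)\circ\bigl((c_{{}^\alpha U,{}^\alpha U^*}\circ b_{{}^\alpha U})\otimes{}^{\alpha^2}U\bigr):{}^{\alpha^2}U\to U .$$ Put $\theta_U^2=({}^U\theta_U)\circ\theta_U:U\to{}^{U\otimes U}U$ and $\theta_U^{-2}=(\theta_U^2)^{-1}$. $U$ is reflexive if it has a stable left dual $U^*$ with $\theta_U^{-2}=\omega_U$; $U^*$ is then a good left dual if moreover $\theta_{U^*}={}^{U^*}(\theta_U^* )$. $\mathcal{N}(\mathcal{T})$ is the full subcategory of $\mathcal{T}$ of the objects admitting a good left dual; for each class $\Phi(U)$ in $\mathcal{N}(\mathcal{T})$ one fixes an object $U_0\in\Phi(U)$ and a good left dual $U_0^*$ of $U_0$, which gives by conjugation a good left dual of every $V\in\Phi(U)$.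
   Formalization: As stated the claim fails; "N(T) is balanced" is proved assuming that U⊗V has some stable left dual for all U, V in N(T), and "N(T) is ribbon" assuming in addition that every good left dual U* has some stable left dual. *)

theory Defs
  imports "HOL-Algebra.Group"
begin

section \<open>Strict tensor categories\<close>

text \<open>
  Objects and arrows have separate types, so the tensor product and the functors
  \<open>\<phi>\<^sub>\<beta>\<close> each have an object part (subscript \<open>o\<close>) and an arrow part (subscript \<open>a\<close>).
  Where an object stands for its identity arrow we write \<open>\<iota> U\<close>.  The category lives on the
  carriers \<open>Obj\<close> and \<open>Arr\<close>; the values of the operations outside them are irrelevant.
\<close>

record ('o, 'a) tensor_cat =
  Obj :: "'o set"
  Arr :: "'a set"
  Dom :: "'a \<Rightarrow> 'o"
  Cod :: "'a \<Rightarrow> 'o"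
  Ident :: "'o \<Rightarrow> 'a" ("\<iota>\<index>")
  Comp :: "'a \<Rightarrow> 'a \<Rightarrow> 'a" (infixr "\<cdot>\<index>" 55)
  TensO :: "'o \<Rightarrow> 'o \<Rightarrow> 'o" (infixr "\<otimes>\<^sub>o\<index>" 65)
  TensA :: "'a \<Rightarrow> 'a \<Rightarrow> 'a" (infixr "\<otimes>\<^sub>a\<index>" 65)
  TUnit :: "'o" ("\<I>\<index>")

definition Hom :: "('o, 'a, 'm) tensor_cat_scheme \<Rightarrow> 'o \<Rightarrow> 'o \<Rightarrow> 'a set" where
  "Hom T U V = {f \<in> Arr T. Dom T f = U \<and> Cod T f = V}"

locale category =
  fixes T :: "('o, 'a, 'm) tensor_cat_scheme" (structure)
  assumes Dom_Obj: "f \<in> Arr T \<Longrightarrow> Dom T f \<in> Obj T"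
    and Cod_Obj: "f \<in> Arr T \<Longrightarrow> Cod T f \<in> Obj T"
    and Ident_Hom: "U \<in> Obj T \<Longrightarrow> \<iota> U \<in> Hom T U U"
    and Comp_Hom: "f \<in> Hom T U V \<Longrightarrow> g \<in> Hom T V W \<Longrightarrow> g \<cdot> f \<in> Hom T U W"
    and Comp_assoc: "f \<in> Hom T U V \<Longrightarrow> g \<in> Hom T V W \<Longrightarrow> h \<in> Hom T W X \<Longrightarrow>
      (h \<cdot> g) \<cdot> f = h \<cdot> (g \<cdot> f)"
    and Comp_Ident_left: "f \<in> Hom T U V \<Longrightarrow> \<iota> V \<cdot> f = f"
    and Comp_Ident_right: "f \<in> Hom T U V \<Longrightarrow> f \<cdot> \<iota> U = f"

locale strict_tensor_category = category +
  assumes TUnit_Obj: "\<I> \<in> Obj T"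
    and TensO_Obj: "U \<in> Obj T \<Longrightarrow> V \<in> Obj T \<Longrightarrow> U \<otimes>\<^sub>o V \<in> Obj T"
    and TensA_Hom: "f \<in> Hom T U U' \<Longrightarrow> g \<in> Hom T V V' \<Longrightarrow>
      f \<otimes>\<^sub>a g \<in> Hom T (U \<otimes>\<^sub>o V) (U' \<otimes>\<^sub>o V')"
    and TensA_Ident: "U \<in> Obj T \<Longrightarrow> V \<in> Obj T \<Longrightarrow> \<iota> U \<otimes>\<^sub>a \<iota> V = \<iota> (U \<otimes>\<^sub>o V)"
    and interchange: "f \<in> Hom T U V \<Longrightarrow> g \<in> Hom T V W \<Longrightarrow>
      f' \<in> Hom T U' V' \<Longrightarrow> g' \<in> Hom T V' W' \<Longrightarrow>
      (g \<cdot> f) \<otimes>\<^sub>a (g' \<cdot> f') = (g \<otimes>\<^sub>a g') \<cdot> (f \<otimes>\<^sub>a f')"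
    and TensO_assoc: "U \<in> Obj T \<Longrightarrow> V \<in> Obj T \<Longrightarrow> W \<in> Obj T \<Longrightarrow>
      (U \<otimes>\<^sub>o V) \<otimes>\<^sub>o W = U \<otimes>\<^sub>o (V \<otimes>\<^sub>o W)"
    and TensA_assoc: "f \<in> Arr T \<Longrightarrow> g \<in> Arr T \<Longrightarrow> h \<in> Arr T \<Longrightarrow>
      (f \<otimes>\<^sub>a g) \<otimes>\<^sub>a h = f \<otimes>\<^sub>a (g \<otimes>\<^sub>a h)"
    and TensO_unit_left: "U \<in> Obj T \<Longrightarrow> \<I> \<otimes>\<^sub>o U = U"
    and TensO_unit_right: "U \<in> Obj T \<Longrightarrow> U \<otimes>\<^sub>o \<I> = U"
    and TensA_unit_left: "f \<in> Arr T \<Longrightarrow> \<iota> \<I> \<otimes>\<^sub>a f = f"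
    and TensA_unit_right: "f \<in> Arr T \<Longrightarrow> f \<otimes>\<^sub>a \<iota> \<I> = f"

definition iso_arr :: "('o, 'a, 'm) tensor_cat_scheme \<Rightarrow> 'a \<Rightarrow> bool" where
  "iso_arr T f \<longleftrightarrow> f \<in> Arr T \<and>
    (\<exists>g \<in> Hom T (Cod T f) (Dom T f). g \<cdot> f = \<iota> (Dom T f) \<and> f \<cdot> g = \<iota> (Cod T f))"
  for T (structure)

definition inverse_arr :: "('o, 'a, 'm) tensor_cat_scheme \<Rightarrow> 'a \<Rightarrow> 'a" where
  "inverse_arr T f =
    (THE g. g \<in> Hom T (Cod T f) (Dom T f) \<and> g \<cdot> f = \<iota> (Dom T f) \<and> f \<cdot> g = \<iota> (Cod T f))"
  for T (structure)

definition strict_tensor_aut ::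
  "('o, 'a, 'm) tensor_cat_scheme \<Rightarrow> ('o \<Rightarrow> 'o) \<Rightarrow> ('a \<Rightarrow> 'a) \<Rightarrow> bool" where
  "strict_tensor_aut T F f \<longleftrightarrow>
    bij_betw F (Obj T) (Obj T) \<and> bij_betw f (Arr T) (Arr T) \<and>
    (\<forall>U V. \<forall>g \<in> Hom T U V. f g \<in> Hom T (F U) (F V)) \<and>
    (\<forall>U \<in> Obj T. f (\<iota> U) = \<iota> (F U)) \<and>
    (\<forall>U V W. \<forall>g \<in> Hom T U V. \<forall>h \<in> Hom T V W. f (h \<cdot> g) = f h \<cdot> f g) \<and>
    F \<I> = \<I> \<and>
    (\<forall>U \<in> Obj T. \<forall>V \<in> Obj T. F (U \<otimes>\<^sub>o V) = F U \<otimes>\<^sub>o F V) \<and>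
    (\<forall>g \<in> Arr T. \<forall>h \<in> Arr T. f (g \<otimes>\<^sub>a h) = f g \<otimes>\<^sub>a f h)"
  for T (structure)


section \<open>T-categories\<close>

text \<open>
  The decomposition of \<open>T\<close> as a disjoint union of subcategories indexed by the group is given
  by the function \<open>Deg\<close> that sends an object to the index of its component.
\<close>

record ('g, 'o, 'a) t_cat = "('o, 'a) tensor_cat" +
  Deg :: "'o \<Rightarrow> 'g"
  ActO :: "'g \<Rightarrow> 'o \<Rightarrow> 'o" ("\<phi>\<^sub>o\<index>")
  ActA :: "'g \<Rightarrow> 'a \<Rightarrow> 'a" ("\<phi>\<^sub>a\<index>")

definition component :: "('g, 'o, 'a, 'm) t_cat_scheme \<Rightarrow> 'g \<Rightarrow> 'o set" where
  "component T \<alpha> = {U \<in> Obj T. Deg T U = \<alpha>}"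

locale t_category = group G + strict_tensor_category T
  for G :: "('g, 'n) monoid_scheme" and T :: "('g, 'o, 'a, 'm) t_cat_scheme" (structure) +
  assumes Deg_carrier: "U \<in> Obj T \<Longrightarrow> Deg T U \<in> carrier G"
    and Deg_Hom: "f \<in> Hom T U V \<Longrightarrow> Deg T U = Deg T V"
    and Deg_TensO: "U \<in> Obj T \<Longrightarrow> V \<in> Obj T \<Longrightarrow>
      Deg T (U \<otimes>\<^sub>o V) = Deg T U \<otimes>\<^bsub>G\<^esub> Deg T V"
    and Act_aut: "\<beta> \<in> carrier G \<Longrightarrow> strict_tensor_aut T (\<phi>\<^sub>o \<beta>) (\<phi>\<^sub>a \<beta>)"
    and ActO_mult: "\<alpha> \<in> carrier G \<Longrightarrow> \<beta> \<in> carrier G \<Longrightarrow> U \<in> Obj T \<Longrightarrow>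
      \<phi>\<^sub>o (\<alpha> \<otimes>\<^bsub>G\<^esub> \<beta>) U = \<phi>\<^sub>o \<alpha> (\<phi>\<^sub>o \<beta> U)"
    and ActA_mult: "\<alpha> \<in> carrier G \<Longrightarrow> \<beta> \<in> carrier G \<Longrightarrow> f \<in> Arr T \<Longrightarrow>
      \<phi>\<^sub>a (\<alpha> \<otimes>\<^bsub>G\<^esub> \<beta>) f = \<phi>\<^sub>a \<alpha> (\<phi>\<^sub>a \<beta> f)"
    and ActO_component: "\<alpha> \<in> carrier G \<Longrightarrow> \<beta> \<in> carrier G \<Longrightarrow>
      \<phi>\<^sub>o \<beta> ` component T \<alpha> = component T (\<beta> \<otimes>\<^bsub>G\<^esub> \<alpha> \<otimes>\<^bsub>G\<^esub> inv\<^bsub>G\<^esub> \<beta>)"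


section \<open>Braidings and twists\<close>

record ('g, 'o, 'a) balanced_t_cat = "('g, 'o, 'a) t_cat" +
  Braid :: "'o \<Rightarrow> 'o \<Rightarrow> 'a"
  Twist :: "'o \<Rightarrow> 'a"

locale braided_t_category = t_category G T
  for G :: "('g, 'n) monoid_scheme" and T :: "('g, 'o, 'a, 'm) balanced_t_cat_scheme" (structure) +
  assumes Braid_Hom: "U \<in> Obj T \<Longrightarrow> V \<in> Obj T \<Longrightarrow>
      Braid T U V \<in> Hom T (U \<otimes>\<^sub>o V) (\<phi>\<^sub>o (Deg T U) V \<otimes>\<^sub>o U)"
    and Braid_iso: "U \<in> Obj T \<Longrightarrow> V \<in> Obj T \<Longrightarrow> iso_arr T (Braid T U V)"
    and Braid_natural: "f \<in> Hom T U U' \<Longrightarrow> g \<in> Hom T V V' \<Longrightarrow>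
      (\<phi>\<^sub>a (Deg T U) g \<otimes>\<^sub>a f) \<cdot> Braid T U V = Braid T U' V' \<cdot> (f \<otimes>\<^sub>a g)"
    and Braid_TensO_left: "U \<in> Obj T \<Longrightarrow> V \<in> Obj T \<Longrightarrow> W \<in> Obj T \<Longrightarrow>
      Braid T (U \<otimes>\<^sub>o V) W =
        (Braid T U (\<phi>\<^sub>o (Deg T V) W) \<otimes>\<^sub>a \<iota> V) \<cdot> (\<iota> U \<otimes>\<^sub>a Braid T V W)"
    and Braid_TensO_right: "U \<in> Obj T \<Longrightarrow> V \<in> Obj T \<Longrightarrow> W \<in> Obj T \<Longrightarrow>
      Braid T U (V \<otimes>\<^sub>o W) =
        (\<iota> (\<phi>\<^sub>o (Deg T U) V) \<otimes>\<^sub>a Braid T U W) \<cdot> (Braid T U V \<otimes>\<^sub>a \<iota> W)"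
    and Braid_Act: "\<beta> \<in> carrier G \<Longrightarrow> U \<in> Obj T \<Longrightarrow> V \<in> Obj T \<Longrightarrow>
      \<phi>\<^sub>a \<beta> (Braid T U V) = Braid T (\<phi>\<^sub>o \<beta> U) (\<phi>\<^sub>o \<beta> V)"

locale balanced_t_category = braided_t_category +
  assumes Twist_Hom: "U \<in> Obj T \<Longrightarrow> Twist T U \<in> Hom T U (\<phi>\<^sub>o (Deg T U) U)"
    and Twist_iso: "U \<in> Obj T \<Longrightarrow> iso_arr T (Twist T U)"
    and Twist_natural: "f \<in> Hom T U V \<Longrightarrow>
      Twist T V \<cdot> f = \<phi>\<^sub>a (Deg T U) f \<cdot> Twist T U"
    and Twist_TensO: "U \<in> Obj T \<Longrightarrow> V \<in> Obj T \<Longrightarrow>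
      Twist T (U \<otimes>\<^sub>o V) =
        Braid T (\<phi>\<^sub>o (Deg T (U \<otimes>\<^sub>o V)) V) (\<phi>\<^sub>o (Deg T U) U) \<cdot>
        Braid T (\<phi>\<^sub>o (Deg T U) U) (\<phi>\<^sub>o (Deg T V) V) \<cdot>
        (Twist T U \<otimes>\<^sub>a Twist T V)"
    and Twist_Act: "\<beta> \<in> carrier G \<Longrightarrow> U \<in> Obj T \<Longrightarrow>
      \<phi>\<^sub>a \<beta> (Twist T U) = Twist T (\<phi>\<^sub>o \<beta> U)"


section \<open>Left duals and ribbon T-categories\<close>

definition left_dual :: "('o, 'a, 'm) tensor_cat_scheme \<Rightarrow> 'o \<Rightarrow> 'o \<Rightarrow> 'a \<Rightarrow> 'a \<Rightarrow> bool" where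
  "left_dual T U U' b d \<longleftrightarrow>
    U \<in> Obj T \<and> U' \<in> Obj T \<and> b \<in> Hom T \<I> (U \<otimes>\<^sub>o U') \<and> d \<in> Hom T (U' \<otimes>\<^sub>o U) \<I> \<and>
    (\<iota> U \<otimes>\<^sub>a d) \<cdot> (b \<otimes>\<^sub>a \<iota> U) = \<iota> U \<and>
    (d \<otimes>\<^sub>a \<iota> U') \<cdot> (\<iota> U' \<otimes>\<^sub>a b) = \<iota> U'"
  for T (structure)

definition stable_left_dual ::
  "('g, 'n) monoid_scheme \<Rightarrow> ('g, 'o, 'a, 'm) t_cat_scheme \<Rightarrow> 'o \<Rightarrow> 'o \<Rightarrow> 'a \<Rightarrow> 'a \<Rightarrow> bool" where
  "stable_left_dual G T U U' b d \<longleftrightarrow> left_dual T U U' b d \<and>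
    (\<forall>\<beta> \<in> carrier G. \<beta> \<otimes>\<^bsub>G\<^esub> Deg T U = Deg T U \<otimes>\<^bsub>G\<^esub> \<beta> \<longrightarrow> \<phi>\<^sub>o \<beta> U = U \<longrightarrow>
      \<phi>\<^sub>a \<beta> b = b \<and> \<phi>\<^sub>a \<beta> d = d)"
  for T (structure)

text \<open>
  The dual \<open>V' \<rightarrow> U'\<close> of \<open>f : U \<rightarrow> V\<close>, where \<open>U'\<close> is a left dual of \<open>U\<close> with unit \<open>b\<close> and \<open>V'\<close> is
  a left dual of \<open>V\<close> with counit \<open>d\<close>.
\<close>

definition dual_arr ::
  "('o, 'a, 'm) tensor_cat_scheme \<Rightarrow> 'o \<Rightarrow> 'a \<Rightarrow> 'o \<Rightarrow> 'a \<Rightarrow> 'a \<Rightarrow> 'a" where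
  "dual_arr T U' b V' d f = (d \<otimes>\<^sub>a \<iota> U') \<cdot> (\<iota> V' \<otimes>\<^sub>a f \<otimes>\<^sub>a \<iota> U') \<cdot> (\<iota> V' \<otimes>\<^sub>a b)"
  for T (structure)

record ('o, 'a) duals =
  Star :: "'o \<Rightarrow> 'o"
  Coev :: "'o \<Rightarrow> 'a"
  Ev :: "'o \<Rightarrow> 'a"

locale left_autonomous_t_category = t_category G T
  for G :: "('g, 'n) monoid_scheme" and T :: "('g, 'o, 'a, 'm) t_cat_scheme" (structure) +
  fixes D :: "('o, 'a, 'd) duals_scheme"
  assumes left_dual_Star: "U \<in> Obj T \<Longrightarrow> left_dual T U (Star D U) (Coev D U) (Ev D U)"
    and Deg_Star: "U \<in> Obj T \<Longrightarrow> Deg T (Star D U) = inv\<^bsub>G\<^esub> (Deg T U)"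
    and Coev_Act: "\<beta> \<in> carrier G \<Longrightarrow> U \<in> Obj T \<Longrightarrow> \<phi>\<^sub>a \<beta> (Coev D U) = Coev D (\<phi>\<^sub>o \<beta> U)"
    and Ev_Act: "\<beta> \<in> carrier G \<Longrightarrow> U \<in> Obj T \<Longrightarrow> \<phi>\<^sub>a \<beta> (Ev D U) = Ev D (\<phi>\<^sub>o \<beta> U)"

locale ribbon_t_category = balanced_t_category G T + left_autonomous_t_category G T D
  for G :: "('g, 'n) monoid_scheme" and T :: "('g, 'o, 'a, 'm) balanced_t_cat_scheme" (structure)
    and D :: "('o, 'a, 'd) duals_scheme" +
  assumes ribbon: "U \<in> Obj T \<Longrightarrow>
    (\<iota> (\<phi>\<^sub>o (Deg T U) U) \<otimes>\<^sub>a Twist T (\<phi>\<^sub>o (Deg T U) (Star D U))) \<cdot> Coev D (\<phi>\<^sub>o (Deg T U) U) =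
    (Twist T U \<otimes>\<^sub>a \<iota> (Star D U)) \<cdot> Coev D U"


section \<open>Good left duals\<close>

definition omega ::
  "('g, 'n) monoid_scheme \<Rightarrow> ('g, 'o, 'a, 'm) balanced_t_cat_scheme \<Rightarrow>
    'o \<Rightarrow> 'o \<Rightarrow> 'a \<Rightarrow> 'a \<Rightarrow> 'a" where
  "omega G T U U' b d =
    (let \<alpha> = Deg T U; \<alpha>2 = \<alpha> \<otimes>\<^bsub>G\<^esub> \<alpha> in
      (\<phi>\<^sub>a \<alpha>2 d \<otimes>\<^sub>a \<iota> U) \<cdot>
      (\<iota> (\<phi>\<^sub>o \<alpha>2 U') \<otimes>\<^sub>a inverse_arr T (Braid T (\<phi>\<^sub>o \<alpha>2 U) U)) \<cdot>
      ((Braid T (\<phi>\<^sub>o \<alpha> U) (\<phi>\<^sub>o \<alpha> U') \<cdot> \<phi>\<^sub>a \<alpha> b) \<otimes>\<^sub>a \<iota> (\<phi>\<^sub>o \<alpha>2 U)))"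
  for T (structure)

definition twist_sq :: "('g, 'o, 'a, 'm) balanced_t_cat_scheme \<Rightarrow> 'o \<Rightarrow> 'a" where
  "twist_sq T U = \<phi>\<^sub>a (Deg T U) (Twist T U) \<cdot> Twist T U"
  for T (structure)

definition reflexive_dual ::
  "('g, 'n) monoid_scheme \<Rightarrow> ('g, 'o, 'a, 'm) balanced_t_cat_scheme \<Rightarrow>
    'o \<Rightarrow> 'o \<Rightarrow> 'a \<Rightarrow> 'a \<Rightarrow> bool" where
  "reflexive_dual G T U U' b d \<longleftrightarrow>
    stable_left_dual G T U U' b d \<and> inverse_arr T (twist_sq T U) = omega G T U U' b d"

definition good_left_dual ::
  "('g, 'n) monoid_scheme \<Rightarrow> ('g, 'o, 'a, 'm) balanced_t_cat_scheme \<Rightarrow>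
    'o \<Rightarrow> 'o \<Rightarrow> 'a \<Rightarrow> 'a \<Rightarrow> bool" where
  "good_left_dual G T U U' b d \<longleftrightarrow> reflexive_dual G T U U' b d \<and>
    Twist T U' =
      \<phi>\<^sub>a (Deg T U')
        (dual_arr T U' b (\<phi>\<^sub>o (Deg T U) U') (\<phi>\<^sub>a (Deg T U) d) (Twist T U))"
  for T (structure)

definition N_Obj ::
  "('g, 'n) monoid_scheme \<Rightarrow> ('g, 'o, 'a, 'm) balanced_t_cat_scheme \<Rightarrow> 'o set" where
  "N_Obj G T = {U \<in> Obj T. \<exists>U' b d. good_left_dual G T U U' b d}"

definition N_cat ::
  "('g, 'n) monoid_scheme \<Rightarrow> ('g, 'o, 'a, 'm) balanced_t_cat_scheme \<Rightarrow>
    ('g, 'o, 'a, 'm) balanced_t_cat_scheme" where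
  "N_cat G T = T\<lparr>Obj := N_Obj G T,
    Arr := {f \<in> Arr T. Dom T f \<in> N_Obj G T \<and> Cod T f \<in> N_Obj G T}\<rparr>"

definition orbit ::
  "('g, 'n) monoid_scheme \<Rightarrow> ('g, 'o, 'a, 'm) t_cat_scheme \<Rightarrow> 'o \<Rightarrow> 'o set" where
  "orbit G T U = {\<phi>\<^sub>o \<beta> U | \<beta>. \<beta> \<in> carrier G}"
  for T (structure)

text \<open>
  The families of duals obtained by fixing one object in each orbit in \<open>N_Obj G T\<close>, fixing a
  good left dual of it, and conjugating along the orbit; \<open>R\<close> is the set of fixed objects.
\<close>

definition chosen_good_duals ::
  "('g, 'n) monoid_scheme \<Rightarrow> ('g, 'o, 'a, 'm) balanced_t_cat_scheme \<Rightarrow>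
    ('o, 'a) duals \<Rightarrow> bool" where
  "chosen_good_duals G T D \<longleftrightarrow>
    (\<exists>R \<subseteq> N_Obj G T.
      (\<forall>U \<in> N_Obj G T. \<exists>!U\<^sub>0. U\<^sub>0 \<in> R \<and> U\<^sub>0 \<in> orbit G T U) \<and>
      (\<forall>U\<^sub>0 \<in> R. good_left_dual G T U\<^sub>0 (Star D U\<^sub>0) (Coev D U\<^sub>0) (Ev D U\<^sub>0)) \<and>
      (\<forall>U\<^sub>0 \<in> R. \<forall>V \<in> orbit G T U\<^sub>0. \<exists>\<beta> \<in> carrier G. V = \<phi>\<^sub>o \<beta> U\<^sub>0 \<and>
        Star D V = \<phi>\<^sub>o \<beta> (Star D U\<^sub>0) \<and>
        Coev D V = \<phi>\<^sub>a \<beta> (Coev D U\<^sub>0) \<and>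
        Ev D V = \<phi>\<^sub>a \<beta> (Ev D U\<^sub>0)))"
  for T (structure)

text \<open>
  Stability refers to equality of objects, and \<open>\<phi>\<^sub>\<beta>\<close> may fix \<open>U \<otimes> V\<close> without fixing \<open>U\<close> and \<open>V\<close>, or
  fix \<open>U\<^sup>*\<close> without fixing \<open>U\<close>.  Hence the left duals \<open>V\<^sup>* \<otimes> U\<^sup>*\<close> of \<open>U \<otimes> V\<close> and \<open>U\<close>, suitably twisted,
  of \<open>U\<^sup>*\<close> need not be stable, and there need not be any stable left dual at all.  The next two
  predicates say that one exists; the twist plays no role in the duals asked for.  The first is
  necessary for \<open>N_Obj G T\<close> to be closed under \<open>\<otimes>\<close>, the second for it to contain the good left
  duals of its objects.
\<close>

definition stable_duals_TensO ::
  "('g, 'n) monoid_scheme \<Rightarrow> ('g, 'o, 'a, 'm) balanced_t_cat_scheme \<Rightarrow> bool" where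
  "stable_duals_TensO G T \<longleftrightarrow>
    (\<forall>U \<in> N_Obj G T. \<forall>V \<in> N_Obj G T. \<exists>W b d. stable_left_dual G T (U \<otimes>\<^sub>o V) W b d)"
  for T (structure)

definition stable_duals_Star ::
  "('g, 'n) monoid_scheme \<Rightarrow> ('g, 'o, 'a, 'm) balanced_t_cat_scheme \<Rightarrow> bool" where
  "stable_duals_Star G T \<longleftrightarrow>
    (\<forall>U U' b d. good_left_dual G T U U' b d \<longrightarrow> (\<exists>W b' d'. stable_left_dual G T U' W b' d'))"

end

theory Submission
  imports Defs
begin

text \<open>
  A left dual is good precisely when it is stable and satisfies the ribbon equation
  \<open>(\<phi>\<^sub>\<alpha> U \<otimes> \<theta>\<^bsub>\<phi>\<^sub>\<alpha> U\<^sup>*\<^esub>) \<phi>\<^sub>\<alpha> b = (\<theta>\<^sub>U \<otimes> U\<^sup>*) b\<close>.  By the triangle identities this equation says that the twist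
  of \<open>U\<^sup>*\<close> is the conjugated dual of the twist of \<open>U\<close>; and since naturality of the twist gives
  \<open>\<theta>\<^bsub>U \<otimes> U\<^sup>*\<^esub> b = b\<close>, it already forces \<open>\<omega>\<^sub>U = \<theta>\<^sub>U\<^sup>-\<^sup>2\<close>.  The ribbon equation does not depend on the left
  dual that is chosen, and it holds for the dual \<open>V\<^sup>* \<otimes> U\<^sup>*\<close> of \<open>U \<otimes> V\<close> and for a conjugate of \<open>U\<close> as a
  dual of \<open>U\<^sup>*\<close>.  Hence, wherever these objects have any stable left dual, that dual is good.
\<close>

section \<open>Calculus in strict tensor categories\<close>

text \<open>Stability need not pass to tensor products or to duals, so the stable dual supplied
  there is an object unrelated to the obvious candidate. The two are compared by h = (d \<otimes>
  W)(U' \<otimes> e), built from the counit of the candidate and the unit of the given dual: h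
  carries one unit to the other, and naturality of the twist at h carries the ribbon equation along.
  The work therefore splits. Twists are computed on candidates with explicit units, where stability
  is not mentioned; stability is treated separately, as a statement about the group elements that
  fix an object.

  The square in \<theta>^2 has this origin: the twist of U \<otimes> U' consists of two twists and
  two crossings, and together they fix the unit. The ribbon equation exchanges the twist on U' for a
  second twist on U, and one crossing is moved to the other side as an inverse. Closing up with the
  counit turns this into the loop \<omega> following \<theta>^2.\<close>

text \<open>
  The axioms are restated with \<open>Arr\<close>, \<open>Dom\<close> and \<open>Cod\<close> instead of \<open>Hom\<close>, so that the simplifier discharges
  the typing conditions by normalising objects, and so that it splits every whiskered composite.
\<close>

context category
begin

lemma Ident_simps [simp]:
  assumes "U \<in> Obj T"
  shows "\<iota> U \<in> Arr T" "Dom T (\<iota> U) = U" "Cod T (\<iota> U) = U"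
  using Ident_Hom[OF assms] by (simp_all add: Hom_def)

lemma Comp_simps [simp]:
  assumes "f \<in> Arr T" "g \<in> Arr T" "Dom T g = Cod T f"
  shows "g \<cdot> f \<in> Arr T" "Dom T (g \<cdot> f) = Dom T f" "Cod T (g \<cdot> f) = Cod T g"
  using Comp_Hom[of f "Dom T f" "Cod T f" g "Cod T g"] assms by (simp_all add: Hom_def)

lemma Comp_assoc' [simp]:
  assumes "f \<in> Arr T" "g \<in> Arr T" "h \<in> Arr T" "Dom T g = Cod T f" "Dom T h = Cod T g"
  shows "(h \<cdot> g) \<cdot> f = h \<cdot> (g \<cdot> f)"
  using Comp_assoc[of f "Dom T f" "Cod T f" g "Cod T g" h "Cod T h"] assms by (simp add: Hom_def)

lemma Comp_Ident [simp]:
  assumes "f \<in> Arr T"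
  shows "Cod T f = V \<Longrightarrow> \<iota> V \<cdot> f = f" "Dom T f = U \<Longrightarrow> f \<cdot> \<iota> U = f"
  using assms Comp_Ident_left Comp_Ident_right by (auto simp: Hom_def)

lemma Dom_Cod_Obj [simp]: "f \<in> Arr T \<Longrightarrow> Dom T f \<in> Obj T" "f \<in> Arr T \<Longrightarrow> Cod T f \<in> Obj T"
  by (rule Dom_Obj, simp) (rule Cod_Obj, simp)

lemma HomD:
  assumes "f \<in> Hom T U V"
  shows "f \<in> Arr T" "Dom T f = U" "Cod T f = V" "U \<in> Obj T" "V \<in> Obj T"
  using assms Dom_Obj Cod_Obj by (auto simp: Hom_def)

text \<open>Composites are kept nested to the right, so \<open>f \<cdot> g\<close> does not occur as
  a subterm once something is composed before it; this is the equation with a tail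
  \<open>k\<close>.\<close>

lemma Comp_reassoc:
  assumes "f \<cdot> g = h" "f \<in> Arr T" "g \<in> Arr T" "k \<in> Arr T" "Dom T f = Cod T g" "Dom T g = Cod T k"
  shows "f \<cdot> g \<cdot> k = h \<cdot> k"
  using assms(2-) unfolding assms(1)[symmetric] by simp

lemma inverse_arr_eqI:
  assumes "f \<in> Hom T U V" "g \<in> Hom T V U" "g \<cdot> f = \<iota> U" "f \<cdot> g = \<iota> V"
  shows "inverse_arr T f = g"
  unfolding inverse_arr_def
proof (rule the_equality)
  show "g \<in> Hom T (Cod T f) (Dom T f) \<and> g \<cdot> f = \<iota> (Dom T f) \<and> f \<cdot> g = \<iota> (Cod T f)"
    using assms by (simp add: Hom_def)
next
  fix h assume h: "h \<in> Hom T (Cod T f) (Dom T f) \<and> h \<cdot> f = \<iota> (Dom T f) \<and> f \<cdot> h = \<iota> (Cod T f)"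
  have "h = (g \<cdot> f) \<cdot> h" using h assms(1,2) unfolding assms(3) by (simp add: Hom_def)
  also have "\<dots> = g \<cdot> (f \<cdot> h)" using h assms(1,2) by (simp add: Hom_def)
  also have "\<dots> = g" using h assms(1,2) by (simp add: Hom_def)
  finally show "h = g" .
qed

lemma iso_arrI:
  assumes "f \<in> Hom T U V" "g \<in> Hom T V U" "g \<cdot> f = \<iota> U" "f \<cdot> g = \<iota> V"
  shows "iso_arr T f"
  unfolding iso_arr_def using assms HomD(1-3)[OF assms(1)] by blast

lemma iso_arr_inverse [simp]:
  assumes "iso_arr T f"
  shows "f \<in> Arr T" "inverse_arr T f \<in> Arr T"
    "Dom T (inverse_arr T f) = Cod T f" "Cod T (inverse_arr T f) = Dom T f"
    "inverse_arr T f \<cdot> f = \<iota> (Dom T f)" "f \<cdot> inverse_arr T f = \<iota> (Cod T f)"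
proof -
  obtain g where g: "f \<in> Arr T" "g \<in> Hom T (Cod T f) (Dom T f)" "g \<cdot> f = \<iota> (Dom T f)"
      "f \<cdot> g = \<iota> (Cod T f)"
    using assms by (auto simp: iso_arr_def)
  then have "inverse_arr T f = g"
    by (intro inverse_arr_eqI[of f "Dom T f" "Cod T f"]) (simp_all add: Hom_def)
  with g show "f \<in> Arr T" "inverse_arr T f \<in> Arr T"
    "Dom T (inverse_arr T f) = Cod T f" "Cod T (inverse_arr T f) = Dom T f"
    "inverse_arr T f \<cdot> f = \<iota> (Dom T f)" "f \<cdot> inverse_arr T f = \<iota> (Cod T f)"
    by (auto simp: Hom_def)
qed

lemma inverse_arr_cancel [simp]:
  assumes "iso_arr T f" "g \<in> Arr T"
  shows "Cod T g = Dom T f \<Longrightarrow> inverse_arr T f \<cdot> f \<cdot> g = g"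
    "Cod T g = Cod T f \<Longrightarrow> f \<cdot> inverse_arr T f \<cdot> g = g"
proof -
  note f = iso_arr_inverse[OF assms(1)]
  show "inverse_arr T f \<cdot> f \<cdot> g = g" if g: "Cod T g = Dom T f"
    by (subst Comp_reassoc[OF f(5)]) (simp_all add: f(1-4) assms(2) g)
  show "f \<cdot> inverse_arr T f \<cdot> g = g" if g: "Cod T g = Cod T f"
    by (subst Comp_reassoc[OF f(6)]) (simp_all add: f(1-4) assms(2) g)
qed

text \<open>Since \<open>f\<close> is known to be invertible, one of the two equations identifies
  the inverse. For \<open>omega\<close> only the composite with the squared twist in front is
  computed.\<close>

lemma iso_arr_inverse_right:
  assumes f: "iso_arr T f" and g: "g \<in> Arr T" "Cod T g = Dom T f" and fg: "f \<cdot> g = \<iota> (Cod T f)"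
  shows "inverse_arr T f = g"
proof -
  note i = iso_arr_inverse[OF f]
  have "inverse_arr T f = inverse_arr T f \<cdot> f \<cdot> g"
    unfolding fg by (rule Comp_Ident(2)[symmetric]) (simp_all only: i)
  also have "\<dots> = g" by (rule inverse_arr_cancel(1)[OF f g])
  finally show ?thesis .
qed

lemma iso_arr_cancel_left:
  assumes f: "iso_arr T f" and g: "g \<in> Arr T" "Cod T g = Dom T f"
    and h: "h \<in> Arr T" "Cod T h = Dom T f" and eq: "f \<cdot> g = f \<cdot> h"
  shows "g = h"
proof -
  have "g = inverse_arr T f \<cdot> f \<cdot> g" by (rule inverse_arr_cancel(1)[OF f g, symmetric])
  also have "\<dots> = h" unfolding eq by (rule inverse_arr_cancel(1)[OF f h])
  finally show ?thesis .
qed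

text \<open>Cancel \<open>f\<close> in \<open>f \<cdot> f = f \<cdot> \<iota> U\<close>. The tensor
  axioms of braiding and twist, specialised to the unit object, make the arrows there idempotent,
  and this lemma then trivialises them.\<close>

lemma idem_iso_eq_Ident:
  assumes "iso_arr T f" "Dom T f = U" "Cod T f = U" "f \<cdot> f = f"
  shows "f = \<iota> U"
  by (rule iso_arr_cancel_left[OF assms(1)])
    (use assms iso_arr_inverse(1)[OF assms(1)] Dom_Cod_Obj(1)[of f] in auto)

end

context strict_tensor_category
begin

declare TUnit_Obj [simp] TensO_Obj [simp] TensO_assoc [simp] TensO_unit_left [simp]
  TensO_unit_right [simp] TensA_assoc [simp] TensA_unit_left [simp] TensA_unit_right [simp]

lemma TensA_simps [simp]:
  assumes "f \<in> Arr T" "g \<in> Arr T"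
  shows "f \<otimes>\<^sub>a g \<in> Arr T" "Dom T (f \<otimes>\<^sub>a g) = Dom T f \<otimes>\<^sub>o Dom T g"
    "Cod T (f \<otimes>\<^sub>a g) = Cod T f \<otimes>\<^sub>o Cod T g"
  using TensA_Hom[of f "Dom T f" "Cod T f" g "Dom T g" "Cod T g"] assms by (simp_all add: Hom_def)

lemma Ident_TensO [simp]: "U \<in> Obj T \<Longrightarrow> V \<in> Obj T \<Longrightarrow> \<iota> (U \<otimes>\<^sub>o V) = \<iota> U \<otimes>\<^sub>a \<iota> V"
  by (simp add: TensA_Ident)

lemma interchange':
  assumes "f \<in> Arr T" "g \<in> Arr T" "f' \<in> Arr T" "g' \<in> Arr T" "Dom T g = Cod T f" "Dom T g' = Cod T f'"
  shows "(g \<otimes>\<^sub>a g') \<cdot> (f \<otimes>\<^sub>a f') = (g \<cdot> f) \<otimes>\<^sub>a (g' \<cdot> f')"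
  using interchange[of f "Dom T f" "Cod T f" g "Cod T g" f' "Dom T f'" "Cod T f'" g' "Cod T g'"] assms
  by (simp add: Hom_def)

lemma whisker [simp]:
  assumes "U \<in> Obj T" "f \<in> Arr T" "g \<in> Arr T" "Dom T g = Cod T f"
  shows "\<iota> U \<otimes>\<^sub>a (g \<cdot> f) = (\<iota> U \<otimes>\<^sub>a g) \<cdot> (\<iota> U \<otimes>\<^sub>a f)"
    "(g \<cdot> f) \<otimes>\<^sub>a \<iota> U = (g \<otimes>\<^sub>a \<iota> U) \<cdot> (f \<otimes>\<^sub>a \<iota> U)"
  using assms by (simp_all add: interchange')

text \<open>Arrows acting on different tensor factors are moved past each other by passing through
  \<open>f \<otimes>\<^sub>a g\<close>: one equation merges the two layers, the other splits them in
  the opposite order.\<close>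

lemma exchange:
  assumes "f \<in> Arr T" "g \<in> Arr T"
  shows "(\<iota> (Cod T f) \<otimes>\<^sub>a g) \<cdot> (f \<otimes>\<^sub>a \<iota> (Dom T g)) = f \<otimes>\<^sub>a g"
    and "(f \<otimes>\<^sub>a \<iota> (Cod T g)) \<cdot> (\<iota> (Dom T f) \<otimes>\<^sub>a g) = f \<otimes>\<^sub>a g"
  using assms by (simp_all add: interchange')

lemma iso_arr_TensA:
  assumes "iso_arr T f" "iso_arr T g"
  shows "iso_arr T (f \<otimes>\<^sub>a g)" "inverse_arr T (f \<otimes>\<^sub>a g) = inverse_arr T f \<otimes>\<^sub>a inverse_arr T g"
proof -
  let ?h = "inverse_arr T f \<otimes>\<^sub>a inverse_arr T g"
  have h: "?h \<in> Hom T (Cod T (f \<otimes>\<^sub>a g)) (Dom T (f \<otimes>\<^sub>a g))"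
    "?h \<cdot> (f \<otimes>\<^sub>a g) = \<iota> (Dom T (f \<otimes>\<^sub>a g))" "(f \<otimes>\<^sub>a g) \<cdot> ?h = \<iota> (Cod T (f \<otimes>\<^sub>a g))"
    using assms by (simp_all add: Hom_def interchange')
  show "iso_arr T (f \<otimes>\<^sub>a g)"
    by (rule iso_arrI[OF _ h]) (use assms in \<open>simp add: Hom_def\<close>)
  show "inverse_arr T (f \<otimes>\<^sub>a g) = ?h"
    by (rule inverse_arr_eqI[OF _ h]) (use assms in \<open>simp add: Hom_def\<close>)
qed

end

lemma (in category) iso_arr_Ident [simp]: "U \<in> Obj T \<Longrightarrow> iso_arr T (\<iota> U)"
  by (rule iso_arrI[of _ U U "\<iota> U"]) (simp_all add: Hom_def)

lemma (in category) inverse_arr_Ident [simp]: "U \<in> Obj T \<Longrightarrow> inverse_arr T (\<iota> U) = \<iota> U"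
  by (rule inverse_arr_eqI[of _ U U]) (auto simp: Hom_def)

lemma (in category) iso_arr_Comp:
  assumes "iso_arr T f" "iso_arr T g" "Dom T g = Cod T f"
  shows "iso_arr T (g \<cdot> f)" "inverse_arr T (g \<cdot> f) = inverse_arr T f \<cdot> inverse_arr T g"
proof -
  let ?h = "inverse_arr T f \<cdot> inverse_arr T g"
  have h: "?h \<in> Hom T (Cod T (g \<cdot> f)) (Dom T (g \<cdot> f))"
    "?h \<cdot> (g \<cdot> f) = \<iota> (Dom T (g \<cdot> f))" "(g \<cdot> f) \<cdot> ?h = \<iota> (Cod T (g \<cdot> f))"
    using assms by (simp_all add: Hom_def)
  show "iso_arr T (g \<cdot> f)"
    by (rule iso_arrI[OF _ h]) (use assms in \<open>simp add: Hom_def\<close>)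
  show "inverse_arr T (g \<cdot> f) = ?h"
    by (rule inverse_arr_eqI[OF _ h]) (use assms in \<open>simp add: Hom_def\<close>)
qed

section \<open>The group action and the degrees of objects\<close>

context t_category
begin

declare Deg_carrier [simp] Deg_TensO [simp]

lemma Deg_eq: "f \<in> Arr T \<Longrightarrow> Deg T (Dom T f) = Deg T (Cod T f)"
  by (rule Deg_Hom[of f]) (simp add: Hom_def)

lemma ActO_Obj [simp]: "\<beta> \<in> carrier G \<Longrightarrow> U \<in> Obj T \<Longrightarrow> \<phi>\<^sub>o \<beta> U \<in> Obj T"
  using Act_aut[of \<beta>] by (auto simp: strict_tensor_aut_def bij_betw_def)

lemma ActA_simps [simp]:
  assumes "\<beta> \<in> carrier G" "f \<in> Arr T"
  shows "\<phi>\<^sub>a \<beta> f \<in> Arr T" "Dom T (\<phi>\<^sub>a \<beta> f) = \<phi>\<^sub>o \<beta> (Dom T f)" "Cod T (\<phi>\<^sub>a \<beta> f) = \<phi>\<^sub>o \<beta> (Cod T f)"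
proof -
  have "f \<in> Hom T (Dom T f) (Cod T f)" using assms by (simp add: Hom_def)
  then have "\<phi>\<^sub>a \<beta> f \<in> Hom T (\<phi>\<^sub>o \<beta> (Dom T f)) (\<phi>\<^sub>o \<beta> (Cod T f))"
    using Act_aut[OF assms(1)] by (auto simp: strict_tensor_aut_def)
  then show "\<phi>\<^sub>a \<beta> f \<in> Arr T" "Dom T (\<phi>\<^sub>a \<beta> f) = \<phi>\<^sub>o \<beta> (Dom T f)" "Cod T (\<phi>\<^sub>a \<beta> f) = \<phi>\<^sub>o \<beta> (Cod T f)"
    by (simp_all add: Hom_def)
qed

lemma Act_functor [simp]:
  assumes "\<beta> \<in> carrier G"
  shows "U \<in> Obj T \<Longrightarrow> \<phi>\<^sub>a \<beta> (\<iota> U) = \<iota> (\<phi>\<^sub>o \<beta> U)"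
    "f \<in> Arr T \<Longrightarrow> g \<in> Arr T \<Longrightarrow> Dom T g = Cod T f \<Longrightarrow> \<phi>\<^sub>a \<beta> (g \<cdot> f) = \<phi>\<^sub>a \<beta> g \<cdot> \<phi>\<^sub>a \<beta> f"
    "\<phi>\<^sub>o \<beta> \<I> = \<I>"
    "U \<in> Obj T \<Longrightarrow> V \<in> Obj T \<Longrightarrow> \<phi>\<^sub>o \<beta> (U \<otimes>\<^sub>o V) = \<phi>\<^sub>o \<beta> U \<otimes>\<^sub>o \<phi>\<^sub>o \<beta> V"
    "f \<in> Arr T \<Longrightarrow> g \<in> Arr T \<Longrightarrow> \<phi>\<^sub>a \<beta> (f \<otimes>\<^sub>a g) = \<phi>\<^sub>a \<beta> f \<otimes>\<^sub>a \<phi>\<^sub>a \<beta> g"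
  using Act_aut[OF assms] by (auto simp: strict_tensor_aut_def Hom_def)

lemma Act_mult [simp]:
  assumes "\<alpha> \<in> carrier G" "\<beta> \<in> carrier G"
  shows "U \<in> Obj T \<Longrightarrow> \<phi>\<^sub>o \<alpha> (\<phi>\<^sub>o \<beta> U) = \<phi>\<^sub>o (\<alpha> \<otimes>\<^bsub>G\<^esub> \<beta>) U"
    "f \<in> Arr T \<Longrightarrow> \<phi>\<^sub>a \<alpha> (\<phi>\<^sub>a \<beta> f) = \<phi>\<^sub>a (\<alpha> \<otimes>\<^bsub>G\<^esub> \<beta>) f"
  using assms by (simp_all add: ActO_mult ActA_mult)

text \<open>The action is given as multiplicative, so the action of 1 is idempotent; being
  injective, it is the identity.\<close>

lemma Act_one [simp]:
  shows "U \<in> Obj T \<Longrightarrow> \<phi>\<^sub>o \<one>\<^bsub>G\<^esub> U = U" "f \<in> Arr T \<Longrightarrow> \<phi>\<^sub>a \<one>\<^bsub>G\<^esub> f = f"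
proof -
  have *: "inj_on (\<phi>\<^sub>o \<one>\<^bsub>G\<^esub>) (Obj T)" "inj_on (\<phi>\<^sub>a \<one>\<^bsub>G\<^esub>) (Arr T)"
    using Act_aut[OF one_closed] by (auto simp: strict_tensor_aut_def bij_betw_def)
  have "\<phi>\<^sub>o \<one>\<^bsub>G\<^esub> (\<phi>\<^sub>o \<one>\<^bsub>G\<^esub> U) = \<phi>\<^sub>o \<one>\<^bsub>G\<^esub> U" if "U \<in> Obj T" using that by simp
  then show "U \<in> Obj T \<Longrightarrow> \<phi>\<^sub>o \<one>\<^bsub>G\<^esub> U = U" using *(1) by (meson ActO_Obj inj_onD one_closed)
  have "\<phi>\<^sub>a \<one>\<^bsub>G\<^esub> (\<phi>\<^sub>a \<one>\<^bsub>G\<^esub> f) = \<phi>\<^sub>a \<one>\<^bsub>G\<^esub> f" if "f \<in> Arr T" using that by simp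
  then show "f \<in> Arr T \<Longrightarrow> \<phi>\<^sub>a \<one>\<^bsub>G\<^esub> f = f" using *(2) by (meson ActA_simps(1) inj_onD one_closed)
qed

lemma Deg_ActO [simp]:
  assumes "\<beta> \<in> carrier G" "U \<in> Obj T"
  shows "Deg T (\<phi>\<^sub>o \<beta> U) = \<beta> \<otimes>\<^bsub>G\<^esub> (Deg T U \<otimes>\<^bsub>G\<^esub> inv\<^bsub>G\<^esub> \<beta>)"
proof -
  have "\<phi>\<^sub>o \<beta> U \<in> component T (\<beta> \<otimes>\<^bsub>G\<^esub> Deg T U \<otimes>\<^bsub>G\<^esub> inv\<^bsub>G\<^esub> \<beta>)"
    using assms ActO_component[of "Deg T U" \<beta>] by (auto simp: component_def)
  then show ?thesis using assms by (simp add: component_def m_assoc)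
qed

lemma Deg_TUnit [simp]: "Deg T \<I> = \<one>\<^bsub>G\<^esub>"
  using Deg_TensO[of \<I> \<I>] by (metis Deg_carrier TUnit_Obj TensO_unit_left l_cancel_one')

lemma group_simps:
  assumes "x \<in> carrier G" "y \<in> carrier G"
  shows "x \<otimes>\<^bsub>G\<^esub> (inv\<^bsub>G\<^esub> x \<otimes>\<^bsub>G\<^esub> y) = y" "inv\<^bsub>G\<^esub> x \<otimes>\<^bsub>G\<^esub> (x \<otimes>\<^bsub>G\<^esub> y) = y"
  using assms by (simp_all add: m_assoc[symmetric])

declare group_simps [simp] m_assoc [simp] inv_mult_group [simp]

text \<open>The unit is an arrow from the tensor unit, which has degree 1, to
  \<open>U \<otimes>\<^sub>o U'\<close>, and arrows preserve degrees.\<close>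

lemma Deg_dual:
  assumes "left_dual T U U' b d"
  shows "Deg T U' = inv\<^bsub>G\<^esub> Deg T U"
proof -
  have "\<one>\<^bsub>G\<^esub> = Deg T U \<otimes>\<^bsub>G\<^esub> Deg T U'"
    using assms Deg_Hom[of b "\<I>" "U \<otimes>\<^sub>o U'"] by (auto simp: left_dual_def)
  then show ?thesis using assms by (metis Deg_carrier left_dual_def inv_equality inv_inv inv_closed)
qed

end

section \<open>The ribbon equation for a left dual\<close>

text \<open>The ribbon axiom for a single triple \<open>U'\<close>, \<open>b\<close>,
  \<open>d\<close>: the conjugate of \<open>b\<close> serves as unit for the conjugated object, so
  the equation makes sense without a chosen family of duals. Stability is kept out of it, because
  the duals on which twists are computed may fail to be stable.\<close>

definition ribbon_dual ::
  "('g, 'n) monoid_scheme \<Rightarrow> ('g, 'o, 'a, 'm) balanced_t_cat_scheme \<Rightarrow>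
    'o \<Rightarrow> 'o \<Rightarrow> 'a \<Rightarrow> 'a \<Rightarrow> bool" where
  "ribbon_dual G T U U' b d \<longleftrightarrow> left_dual T U U' b d \<and>
    (\<iota> (\<phi>\<^sub>o (Deg T U) U) \<otimes>\<^sub>a Twist T (\<phi>\<^sub>o (Deg T U) U')) \<cdot> \<phi>\<^sub>a (Deg T U) b =
    (Twist T U \<otimes>\<^sub>a \<iota> U') \<cdot> b"
  for T (structure)

section \<open>Consequences of naturality for braidings and twists\<close>

context braided_t_category
begin

lemma Braid_simps [simp]:
  assumes "U \<in> Obj T" "V \<in> Obj T"
  shows "Braid T U V \<in> Arr T" "Dom T (Braid T U V) = U \<otimes>\<^sub>o V"
    "Cod T (Braid T U V) = \<phi>\<^sub>o (Deg T U) V \<otimes>\<^sub>o U" "iso_arr T (Braid T U V)"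
    "\<beta> \<in> carrier G \<Longrightarrow> \<phi>\<^sub>a \<beta> (Braid T U V) = Braid T (\<phi>\<^sub>o \<beta> U) (\<phi>\<^sub>o \<beta> V)"
  using Braid_Hom[OF assms] Braid_iso[OF assms] Braid_Act[OF _ assms] by (simp_all add: Hom_def)

lemma Braid_nat:
  assumes "f \<in> Arr T" "g \<in> Arr T"
  shows "Braid T (Cod T f) (Cod T g) \<cdot> (f \<otimes>\<^sub>a g) =
    (\<phi>\<^sub>a (Deg T (Dom T f)) g \<otimes>\<^sub>a f) \<cdot> Braid T (Dom T f) (Dom T g)"
  using Braid_natural[of f "Dom T f" "Cod T f" g "Dom T g" "Cod T g"] assms by (simp add: Hom_def)

lemma Braid_unit [simp]:
  assumes "U \<in> Obj T"
  shows "Braid T \<I> U = \<iota> U" "Braid T U \<I> = \<iota> U"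
proof -
  show "Braid T \<I> U = \<iota> U"
    by (rule idem_iso_eq_Ident) (use Braid_TensO_left[of \<I> \<I> U] assms in simp_all)
  show "Braid T U \<I> = \<iota> U"
    by (rule idem_iso_eq_Ident) (use Braid_TensO_right[of U \<I> \<I>] assms in simp_all)
qed

lemma Braid_inverse_nat:
  assumes "f \<in> Arr T" "g \<in> Arr T"
  shows "inverse_arr T (Braid T (Cod T f) (Cod T g)) \<cdot> (\<phi>\<^sub>a (Deg T (Dom T f)) g \<otimes>\<^sub>a f) =
    (f \<otimes>\<^sub>a g) \<cdot> inverse_arr T (Braid T (Dom T f) (Dom T g))"
proof (rule iso_arr_cancel_left[of "Braid T (Cod T f) (Cod T g)"])
  show "Braid T (Cod T f) (Cod T g) \<cdot> inverse_arr T (Braid T (Cod T f) (Cod T g)) \<cdot>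
      (\<phi>\<^sub>a (Deg T (Dom T f)) g \<otimes>\<^sub>a f) =
    Braid T (Cod T f) (Cod T g) \<cdot> (f \<otimes>\<^sub>a g) \<cdot> inverse_arr T (Braid T (Dom T f) (Dom T g))"
    using Comp_reassoc[OF Braid_nat[OF assms], of "inverse_arr T (Braid T (Dom T f) (Dom T g))"] assms
    by (simp add: Deg_eq interchange')
qed (use assms in \<open>simp_all add: Deg_eq\<close>)

text \<open>The two inverse crossings make up the inverse braiding of
  \<open>Y \<otimes>\<^sub>o X\<close> with \<open>X\<close>. As
  \<open>Y \<otimes>\<^sub>o X\<close> has degree 1, naturality at \<open>d\<close> pulls the strand
  \<open>X\<close> off the counit, and a triangle identity remains. This evaluates the loop in
  \<open>omega\<close> once the squared twist is absorbed.\<close>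

lemma left_dual_double_crossing:
  assumes "left_dual T X Y b d"
  shows "(d \<otimes>\<^sub>a \<iota> X) \<cdot> (\<iota> Y \<otimes>\<^sub>a inverse_arr T (Braid T X X)) \<cdot>
    ((inverse_arr T (Braid T Y (\<phi>\<^sub>o (Deg T X) X)) \<cdot> b) \<otimes>\<^sub>a \<iota> X) = \<iota> X"
proof -
  note Deg_dual[OF assms, simp]
  have [simp]: "X \<in> Obj T" "Y \<in> Obj T" "b \<in> Arr T" "Dom T b = \<I>" "Cod T b = X \<otimes>\<^sub>o Y"
    "d \<in> Arr T" "Dom T d = Y \<otimes>\<^sub>o X" "Cod T d = \<I>"
    and zz: "(\<iota> X \<otimes>\<^sub>a d) \<cdot> (b \<otimes>\<^sub>a \<iota> X) = \<iota> X"
    using assms by (simp_all add: left_dual_def Hom_def)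
  have inv: "inverse_arr T (Braid T (Y \<otimes>\<^sub>o X) X) =
      (\<iota> Y \<otimes>\<^sub>a inverse_arr T (Braid T X X)) \<cdot> (inverse_arr T (Braid T Y (\<phi>\<^sub>o (Deg T X) X)) \<otimes>\<^sub>a \<iota> X)"
    by (simp add: Braid_TensO_left iso_arr_Comp iso_arr_TensA)
  have "(d \<otimes>\<^sub>a \<iota> X) \<cdot> inverse_arr T (Braid T (Y \<otimes>\<^sub>o X) X) = \<iota> X \<otimes>\<^sub>a d"
    using Braid_inverse_nat[of d "\<iota> X"] by simp
  then have "\<iota> X \<otimes>\<^sub>a d = (d \<otimes>\<^sub>a \<iota> X) \<cdot> (\<iota> Y \<otimes>\<^sub>a inverse_arr T (Braid T X X)) \<cdot>
      (inverse_arr T (Braid T Y (\<phi>\<^sub>o (Deg T X) X)) \<otimes>\<^sub>a \<iota> X)"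
    by (simp add: inv)
  with zz show ?thesis by simp
qed

end

context balanced_t_category
begin

lemma Twist_simps [simp]:
  assumes "U \<in> Obj T"
  shows "Twist T U \<in> Arr T" "Dom T (Twist T U) = U"
    "Cod T (Twist T U) = \<phi>\<^sub>o (Deg T U) U" "iso_arr T (Twist T U)"
    "\<beta> \<in> carrier G \<Longrightarrow> \<phi>\<^sub>a \<beta> (Twist T U) = Twist T (\<phi>\<^sub>o \<beta> U)"
  using Twist_Hom[OF assms] Twist_iso[OF assms] Twist_Act[OF _ assms] by (simp_all add: Hom_def)

lemma Twist_nat:
  assumes "f \<in> Arr T"
  shows "Twist T (Cod T f) \<cdot> f = \<phi>\<^sub>a (Deg T (Dom T f)) f \<cdot> Twist T (Dom T f)"
  using Twist_natural[of f "Dom T f" "Cod T f"] assms by (simp add: Hom_def)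

lemma Twist_unit [simp]: "Twist T \<I> = \<iota> \<I>"
proof (rule idem_iso_eq_Ident)
  show "Twist T \<I> \<cdot> Twist T \<I> = Twist T \<I>"
    using Twist_TensO[of \<I> \<I>] exchange(1)[of "Twist T \<I>" "Twist T \<I>"] by simp
qed simp_all

lemma ribbon_dualD:
  assumes "ribbon_dual G T U U' b d"
  shows "left_dual T U U' b d" "U \<in> Obj T" "U' \<in> Obj T" "b \<in> Arr T" "Dom T b = \<I>"
    "Cod T b = U \<otimes>\<^sub>o U'" "d \<in> Arr T" "Dom T d = U' \<otimes>\<^sub>o U" "Cod T d = \<I>"
    "Deg T U' = inv\<^bsub>G\<^esub> Deg T U"
    "(\<iota> U \<otimes>\<^sub>a d) \<cdot> (b \<otimes>\<^sub>a \<iota> U) = \<iota> U" "(d \<otimes>\<^sub>a \<iota> U') \<cdot> (\<iota> U' \<otimes>\<^sub>a b) = \<iota> U'"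
    "(\<iota> (\<phi>\<^sub>o (Deg T U) U) \<otimes>\<^sub>a Twist T (\<phi>\<^sub>o (Deg T U) U')) \<cdot> \<phi>\<^sub>a (Deg T U) b =
      (Twist T U \<otimes>\<^sub>a \<iota> U') \<cdot> b"
  using assms Deg_dual[of U U' b d] by (simp_all add: ribbon_dual_def left_dual_def Hom_def)

text \<open>This is \<theta> b = b spelled out by the tensor axiom of the twist. The tensor product
  \<open>U \<otimes>\<^sub>o U'\<close> has degree 1, which is why \<open>U'\<close> itself is the
  first object of the outer crossing.\<close>

lemma Twist_coev:
  assumes "left_dual T U U' b d"
  shows "Braid T U' (\<phi>\<^sub>o (Deg T U) U) \<cdot> Braid T (\<phi>\<^sub>o (Deg T U) U) (\<phi>\<^sub>o (inv\<^bsub>G\<^esub> Deg T U) U') \<cdot>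
    (Twist T U \<otimes>\<^sub>a Twist T U') \<cdot> b = b"
proof -
  note Deg_dual[OF assms, simp]
  have [simp]: "U \<in> Obj T" "U' \<in> Obj T" "b \<in> Arr T" "Dom T b = \<I>" "Cod T b = U \<otimes>\<^sub>o U'"
    using assms by (simp_all add: left_dual_def Hom_def)
  show ?thesis using Twist_nat[of b] by (simp add: Twist_TensO)
qed

lemma left_dual_Act:
  assumes "left_dual T U U' b d" "\<beta> \<in> carrier G"
  shows "left_dual T (\<phi>\<^sub>o \<beta> U) (\<phi>\<^sub>o \<beta> U') (\<phi>\<^sub>a \<beta> b) (\<phi>\<^sub>a \<beta> d)"
proof -
  have [simp]: "U \<in> Obj T" "U' \<in> Obj T" "b \<in> Arr T" "Dom T b = \<I>" "Cod T b = U \<otimes>\<^sub>o U'"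
    "d \<in> Arr T" "Dom T d = U' \<otimes>\<^sub>o U" "Cod T d = \<I>"
    and z: "(\<iota> U \<otimes>\<^sub>a d) \<cdot> (b \<otimes>\<^sub>a \<iota> U) = \<iota> U" "(d \<otimes>\<^sub>a \<iota> U') \<cdot> (\<iota> U' \<otimes>\<^sub>a b) = \<iota> U'"
    using assms by (simp_all add: left_dual_def Hom_def)
  show ?thesis using arg_cong[OF z(1), of "\<phi>\<^sub>a \<beta>"] arg_cong[OF z(2), of "\<phi>\<^sub>a \<beta>"] assms(2)
    by (simp add: left_dual_def Hom_def)
qed

lemma ribbon_dual_Act:
  assumes "ribbon_dual G T U U' b d" "\<beta> \<in> carrier G"
  shows "ribbon_dual G T (\<phi>\<^sub>o \<beta> U) (\<phi>\<^sub>o \<beta> U') (\<phi>\<^sub>a \<beta> b) (\<phi>\<^sub>a \<beta> d)"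
proof -
  note [simp] = ribbon_dualD(2-10)[OF assms(1)]
  show ?thesis unfolding ribbon_dual_def
    using left_dual_Act[OF ribbon_dualD(1)[OF assms(1)] assms(2)]
      arg_cong[OF ribbon_dualD(13)[OF assms(1)], of "\<phi>\<^sub>a \<beta>"] assms(2)
    by simp
qed

text \<open>
  After composing with the squared twist, naturality and \<open>\<theta>\<^bsub>X \<otimes> X\<^sup>*\<^esub> b\<^sub>X = b\<^sub>X\<close> turn the
  crossing in \<open>\<omega>\<^sub>U\<close> over the unit into an inverse crossing.
\<close>

lemma ribbon_dual_omega:
  assumes rd: "ribbon_dual G T U U' b d"
  shows "inverse_arr T (twist_sq T U) = omega G T U U' b d"
proof -
  note [simp] = ribbon_dualD(2-10)[OF rd]
  define a where "a = Deg T U"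
  have a [simp]: "Deg T U = a" "a \<in> carrier G" by (simp_all add: a_def)
  \<comment> \<open>\<open>U\<close> and its conjugate by \<open>a\<close> both have degree
    \<open>a\<close>, so \<open>X\<close> is the codomain of the squared twist; \<open>Y\<close>,
    \<open>bX\<close>, \<open>dX\<close> form its conjugated dual.\<close>
  define X where "X = \<phi>\<^sub>o (a \<otimes>\<^bsub>G\<^esub> a) U"
  define Y where "Y = \<phi>\<^sub>o (a \<otimes>\<^bsub>G\<^esub> a) U'"
  define bX where "bX = \<phi>\<^sub>a (a \<otimes>\<^bsub>G\<^esub> a) b"
  define dX where "dX = \<phi>\<^sub>a (a \<otimes>\<^bsub>G\<^esub> a) d"
  have rX: "ribbon_dual G T X Y bX dX"
    using ribbon_dual_Act[OF rd, of "a \<otimes>\<^bsub>G\<^esub> a"] by (simp add: X_def Y_def bX_def dX_def)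
  note [simp] = ribbon_dualD(2-9)[OF rX]
  have [simp]: "Deg T X = a" "Deg T Y = inv\<^bsub>G\<^esub> a" by (simp_all add: X_def Y_def)
  define t where "t = twist_sq T U"
  have [simp]: "t \<in> Arr T" "Dom T t = U" "Cod T t = X" "iso_arr T t"
    by (simp_all add: t_def twist_sq_def X_def iso_arr_Comp)
  define B where "B = Braid T (\<phi>\<^sub>o a U) (\<phi>\<^sub>o a U') \<cdot> \<phi>\<^sub>a a b"
  have [simp]: "B \<in> Arr T" "Dom T B = \<I>" "Cod T B = Y \<otimes>\<^sub>o \<phi>\<^sub>o a U"
    by (simp_all add: B_def Y_def)
  let ?c = "inverse_arr T (Braid T X U)" and ?c' = "inverse_arr T (Braid T X X)"
  let ?e = "inverse_arr T (Braid T Y (\<phi>\<^sub>o a X))"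
  \<comment> \<open>\<open>\<phi>\<^sub>a a t\<close> is the twist of
    \<open>\<phi>\<^sub>o a U\<close> followed by that of \<open>X\<close>. The ribbon equation
    trades the former for the twist of \<open>Y\<close>; then \<open>X\<close> and \<open>Y\<close>
    are both twisted on top of \<open>bX\<close>, and \<open>Twist_coev\<close> removes these twists
    together with two crossings.\<close>
  have B: "(\<iota> Y \<otimes>\<^sub>a \<phi>\<^sub>a a t) \<cdot> B = ?e \<cdot> bX"
  proof (rule iso_arr_cancel_left[of "Braid T Y (\<phi>\<^sub>o a X)"])
    have nat: "(\<iota> Y \<otimes>\<^sub>a \<phi>\<^sub>a a t) \<cdot> Braid T (\<phi>\<^sub>o a U) (\<phi>\<^sub>o a U') =
        Braid T (\<phi>\<^sub>o a X) (\<phi>\<^sub>o a U') \<cdot> (\<phi>\<^sub>a a t \<otimes>\<^sub>a \<iota> (\<phi>\<^sub>o a U'))"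
      using Braid_nat[of "\<phi>\<^sub>a a t" "\<iota> (\<phi>\<^sub>o a U')"] by (simp add: Y_def)
    have rib: "(Twist T (\<phi>\<^sub>o a U) \<otimes>\<^sub>a \<iota> (\<phi>\<^sub>o a U')) \<cdot> \<phi>\<^sub>a a b = (\<iota> X \<otimes>\<^sub>a Twist T Y) \<cdot> bX"
      using ribbon_dualD(13)[OF ribbon_dual_Act[OF rd, of a]] by (simp add: X_def Y_def bX_def)
    have "(\<iota> Y \<otimes>\<^sub>a \<phi>\<^sub>a a t) \<cdot> B =
        Braid T (\<phi>\<^sub>o a X) (\<phi>\<^sub>o a U') \<cdot> (\<phi>\<^sub>a a t \<otimes>\<^sub>a \<iota> (\<phi>\<^sub>o a U')) \<cdot> \<phi>\<^sub>a a b"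
      unfolding B_def by (subst Comp_reassoc[OF nat]) (simp_all add: X_def Y_def)
    also have "(\<phi>\<^sub>a a t \<otimes>\<^sub>a \<iota> (\<phi>\<^sub>o a U')) \<cdot> \<phi>\<^sub>a a b =
        (Twist T X \<otimes>\<^sub>a \<iota> (\<phi>\<^sub>o a U')) \<cdot> (Twist T (\<phi>\<^sub>o a U) \<otimes>\<^sub>a \<iota> (\<phi>\<^sub>o a U')) \<cdot> \<phi>\<^sub>a a b"
      by (simp add: t_def twist_sq_def X_def)
    also have "\<dots> = (Twist T X \<otimes>\<^sub>a Twist T Y) \<cdot> bX"
      unfolding rib using Comp_reassoc[OF exchange(2)[of "Twist T X" "Twist T Y"], of bX]
      by (simp add: Y_def)
    finally show "Braid T Y (\<phi>\<^sub>o a X) \<cdot> (\<iota> Y \<otimes>\<^sub>a \<phi>\<^sub>a a t) \<cdot> B = Braid T Y (\<phi>\<^sub>o a X) \<cdot> ?e \<cdot> bX"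
      using Twist_coev[OF ribbon_dualD(1)[OF rX]] by (simp add: Y_def)
  qed (simp_all add: X_def Y_def)
  have om: "omega G T U U' b d = (dX \<otimes>\<^sub>a \<iota> U) \<cdot> (\<iota> Y \<otimes>\<^sub>a ?c) \<cdot> (B \<otimes>\<^sub>a \<iota> X)"
    by (simp add: omega_def Let_def X_def Y_def bX_def dX_def B_def)
  \<comment> \<open>\<open>t\<close> is pushed through the three layers of \<open>om\<close>: past
    the counit, through the inverse crossing, where it becomes \<open>\<phi>\<^sub>a a t\<close>,
    and onto \<open>B\<close>.\<close>
  have 1: "t \<cdot> (dX \<otimes>\<^sub>a \<iota> U) = (dX \<otimes>\<^sub>a \<iota> X) \<cdot> (\<iota> Y \<otimes>\<^sub>a \<iota> X \<otimes>\<^sub>a t)"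
    using exchange[of dX t] by simp
  have 2: "(\<iota> X \<otimes>\<^sub>a t) \<cdot> ?c = ?c' \<cdot> (\<phi>\<^sub>a a t \<otimes>\<^sub>a \<iota> X)"
    using Braid_inverse_nat[of "\<iota> X" t] by simp
  have 2: "(\<iota> Y \<otimes>\<^sub>a \<iota> X \<otimes>\<^sub>a t) \<cdot> (\<iota> Y \<otimes>\<^sub>a ?c) = (\<iota> Y \<otimes>\<^sub>a ?c') \<cdot> (\<iota> Y \<otimes>\<^sub>a \<phi>\<^sub>a a t \<otimes>\<^sub>a \<iota> X)"
    using arg_cong[OF 2, of "\<lambda>f. \<iota> Y \<otimes>\<^sub>a f"] by simp
  have 3: "(\<iota> Y \<otimes>\<^sub>a \<phi>\<^sub>a a t \<otimes>\<^sub>a \<iota> X) \<cdot> (B \<otimes>\<^sub>a \<iota> X) = (?e \<cdot> bX) \<otimes>\<^sub>a \<iota> X"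
    using arg_cong[OF B, of "\<lambda>f. f \<otimes>\<^sub>a \<iota> X"] by simp
  have "t \<cdot> omega G T U U' b d = \<iota> X"
  proof -
    have "t \<cdot> omega G T U U' b d =
      (dX \<otimes>\<^sub>a \<iota> X) \<cdot> ((\<iota> Y \<otimes>\<^sub>a \<iota> X \<otimes>\<^sub>a t) \<cdot> (\<iota> Y \<otimes>\<^sub>a ?c)) \<cdot> (B \<otimes>\<^sub>a \<iota> X)"
      unfolding om by (subst Comp_reassoc[OF 1]) simp_all
    also have "\<dots> = (dX \<otimes>\<^sub>a \<iota> X) \<cdot> (\<iota> Y \<otimes>\<^sub>a ?c') \<cdot> (\<iota> Y \<otimes>\<^sub>a \<phi>\<^sub>a a t \<otimes>\<^sub>a \<iota> X) \<cdot> (B \<otimes>\<^sub>a \<iota> X)"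
      unfolding 2 by simp
    also have "\<dots> = \<iota> X"
      unfolding 3 using left_dual_double_crossing[OF ribbon_dualD(1)[OF rX]] by simp
    finally show ?thesis .
  qed
  then show ?thesis
    unfolding t_def[symmetric] by (intro iso_arr_inverse_right) (simp_all add: om)
qed

end

text \<open>Bending the leg \<open>V\<close> with \<open>d\<close> is a bijection from arrows \<I>
  \<rightarrow> V \<otimes> U' to arrows V' \<rightarrow> U', whose inverse sends \<open>s\<close>
  to \<open>(\<iota> V \<otimes>\<^sub>a s) \<cdot> e\<close>. The dual arrow is the image of
  \<open>(f \<otimes>\<^sub>a \<iota> U') \<cdot> b\<close>. Each triangle identity gives one of the
  two directions.\<close>

lemma (in strict_tensor_category) dual_arr_iff:
  assumes dual: "left_dual T V V' e d" and f: "f \<in> Hom T U V" and b: "b \<in> Hom T \<I> (U \<otimes>\<^sub>o U')"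
    and s: "s \<in> Hom T V' U'"
  shows "(\<iota> V \<otimes>\<^sub>a s) \<cdot> e = (f \<otimes>\<^sub>a \<iota> U') \<cdot> b \<longleftrightarrow> s = dual_arr T U' b V' d f"
proof -
  have [simp]: "V \<in> Obj T" "V' \<in> Obj T" "e \<in> Arr T" "Dom T e = \<I>" "Cod T e = V \<otimes>\<^sub>o V'"
    "d \<in> Arr T" "Dom T d = V' \<otimes>\<^sub>o V" "Cod T d = \<I>"
    and z: "(\<iota> V \<otimes>\<^sub>a d) \<cdot> (e \<otimes>\<^sub>a \<iota> V) = \<iota> V" "(d \<otimes>\<^sub>a \<iota> V') \<cdot> (\<iota> V' \<otimes>\<^sub>a e) = \<iota> V'"
    using dual by (simp_all add: left_dual_def Hom_def)
  note [simp] = HomD[OF f] HomD(1-3)[OF b] HomD[OF s]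
  let ?t = "dual_arr T U' b V' d f" and ?g = "(f \<otimes>\<^sub>a \<iota> U') \<cdot> b"
  have t: "?t = (d \<otimes>\<^sub>a \<iota> U') \<cdot> (\<iota> V' \<otimes>\<^sub>a ?g)"
    by (simp add: dual_arr_def)
  have "s = ?t" if eq: "(\<iota> V \<otimes>\<^sub>a s) \<cdot> e = ?g"
  proof -
    have x: "(d \<otimes>\<^sub>a \<iota> U') \<cdot> (\<iota> V' \<otimes>\<^sub>a \<iota> V \<otimes>\<^sub>a s) = s \<cdot> (d \<otimes>\<^sub>a \<iota> V')"
      using exchange[of d s] by simp
    have "?t = (d \<otimes>\<^sub>a \<iota> U') \<cdot> (\<iota> V' \<otimes>\<^sub>a \<iota> V \<otimes>\<^sub>a s) \<cdot> (\<iota> V' \<otimes>\<^sub>a e)"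
      unfolding t eq[symmetric] by simp
    also have "\<dots> = s \<cdot> (d \<otimes>\<^sub>a \<iota> V') \<cdot> (\<iota> V' \<otimes>\<^sub>a e)"
      by (subst Comp_reassoc[OF x]) simp_all
    finally show ?thesis using z(2) by simp
  qed
  moreover have "(\<iota> V \<otimes>\<^sub>a ?t) \<cdot> e = ?g"
  proof -
    have g: "?g \<in> Arr T" "Dom T ?g = \<I>" "Cod T ?g = V \<otimes>\<^sub>o U'" by simp_all
    have x: "(\<iota> V \<otimes>\<^sub>a \<iota> V' \<otimes>\<^sub>a ?g) \<cdot> e = (e \<otimes>\<^sub>a \<iota> V \<otimes>\<^sub>a \<iota> U') \<cdot> ?g"
      using exchange[of e ?g] by simp
    have y: "(\<iota> V \<otimes>\<^sub>a d \<otimes>\<^sub>a \<iota> U') \<cdot> (e \<otimes>\<^sub>a \<iota> V \<otimes>\<^sub>a \<iota> U') = \<iota> V \<otimes>\<^sub>a \<iota> U'"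
      using arg_cong[OF z(1), of "\<lambda>f. f \<otimes>\<^sub>a \<iota> U'"] by simp
    have "(\<iota> V \<otimes>\<^sub>a ?t) \<cdot> e = (\<iota> V \<otimes>\<^sub>a d \<otimes>\<^sub>a \<iota> U') \<cdot> (\<iota> V \<otimes>\<^sub>a \<iota> V' \<otimes>\<^sub>a ?g) \<cdot> e"
      unfolding t by simp
    also have "\<dots> = (\<iota> V \<otimes>\<^sub>a d \<otimes>\<^sub>a \<iota> U') \<cdot> (e \<otimes>\<^sub>a \<iota> V \<otimes>\<^sub>a \<iota> U') \<cdot> ?g"
      unfolding x ..
    also have "\<dots> = ?g"
      by (subst Comp_reassoc[OF y]) (simp_all flip: Ident_TensO)
    finally show ?thesis .
  qed
  ultimately show ?thesis by blast
qed

section \<open>Good duals and the ribbon equation; change of the dual\<close>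

context balanced_t_category
begin

text \<open>With \<alpha> the degree of \<open>U\<close>, \<open>dual_arr_iff\<close> is used for
  \<open>Twist T U\<close> as an arrow to \<phi>_\<alpha> U: the ribbon equation becomes a formula
  for the twist of \<phi>_\<alpha> U'. Acting with the degree of \<open>U'\<close>, which is inverse
  to \<alpha>, turns that formula into the condition on \<open>Twist T U'\<close>.\<close>

lemma good_left_dual_iff:
  "good_left_dual G T U U' b d \<longleftrightarrow> stable_left_dual G T U U' b d \<and> ribbon_dual G T U U' b d"
proof -
  have main: "Twist T U' = \<phi>\<^sub>a (Deg T U') (dual_arr T U' b (\<phi>\<^sub>o (Deg T U) U') (\<phi>\<^sub>a (Deg T U) d) (Twist T U))
      \<longleftrightarrow> ribbon_dual G T U U' b d" if dual: "left_dual T U U' b d"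
  proof -
    have [simp]: "U \<in> Obj T" "U' \<in> Obj T" "b \<in> Arr T" "Dom T b = \<I>" "Cod T b = U \<otimes>\<^sub>o U'"
      "d \<in> Arr T" "Dom T d = U' \<otimes>\<^sub>o U" "Cod T d = \<I>"
      using dual by (simp_all add: left_dual_def Hom_def)
    note [simp] = Deg_dual[OF dual]
    let ?t = "dual_arr T U' b (\<phi>\<^sub>o (Deg T U) U') (\<phi>\<^sub>a (Deg T U) d) (Twist T U)"
    have [simp]: "?t \<in> Arr T" by (simp add: dual_arr_def)
    have "ribbon_dual G T U U' b d \<longleftrightarrow> Twist T (\<phi>\<^sub>o (Deg T U) U') = ?t"
      unfolding ribbon_dual_def using that
      by (subst dual_arr_iff[OF left_dual_Act[OF that], of "Deg T U" "Twist T U" U b U'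
          "Twist T (\<phi>\<^sub>o (Deg T U) U')"]) (simp_all add: Hom_def)
    also have "\<dots> \<longleftrightarrow> \<phi>\<^sub>a (Deg T U) (Twist T U') = ?t" by simp
    also have "\<dots> \<longleftrightarrow> Twist T U' = \<phi>\<^sub>a (Deg T U') ?t"
    proof
      assume "\<phi>\<^sub>a (Deg T U) (Twist T U') = ?t"
      then have "\<phi>\<^sub>a (Deg T U') (\<phi>\<^sub>a (Deg T U) (Twist T U')) = \<phi>\<^sub>a (Deg T U') ?t" by simp
      then show "Twist T U' = \<phi>\<^sub>a (Deg T U') ?t" by simp
    next
      assume "Twist T U' = \<phi>\<^sub>a (Deg T U') ?t"
      then have "\<phi>\<^sub>a (Deg T U) (Twist T U') = \<phi>\<^sub>a (Deg T U) (\<phi>\<^sub>a (Deg T U') ?t)" by simp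
      then show "\<phi>\<^sub>a (Deg T U) (Twist T U') = ?t" by simp
    qed
    finally show ?thesis ..
  qed
  show ?thesis
    unfolding good_left_dual_def reflexive_dual_def
    using main ribbon_dual_omega by (auto simp: stable_left_dual_def)
qed

text \<open>The triple \<open>U'\<close>, \<open>b\<close>, \<open>d\<close> is the candidate on
  which the equation is known. The triangle identity \<open>z\<close> shows that the comparison
  arrow \<open>h\<close> from \<open>U'\<close> to \<open>W\<close> satisfies
  \<open>e = (\<iota> U \<otimes>\<^sub>a h) \<cdot> b\<close>, and the twist is natural at
  \<open>h\<close>.\<close>

lemma ribbon_dual_change:
  assumes dual: "left_dual T U W e f"
    and b: "b \<in> Hom T \<I> (U \<otimes>\<^sub>o U')" and d: "d \<in> Hom T (U' \<otimes>\<^sub>o U) \<I>" and U': "U' \<in> Obj T"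
    and z: "(\<iota> U \<otimes>\<^sub>a d) \<cdot> (b \<otimes>\<^sub>a \<iota> U) = \<iota> U"
    and rib: "(\<iota> (\<phi>\<^sub>o (Deg T U) U) \<otimes>\<^sub>a Twist T (\<phi>\<^sub>o (Deg T U) U')) \<cdot> \<phi>\<^sub>a (Deg T U) b =
      (Twist T U \<otimes>\<^sub>a \<iota> U') \<cdot> b"
  shows "ribbon_dual G T U W e f"
proof -
  have [simp]: "U \<in> Obj T" "W \<in> Obj T" "e \<in> Arr T" "Dom T e = \<I>" "Cod T e = U \<otimes>\<^sub>o W"
    using dual by (simp_all add: left_dual_def Hom_def)
  note [simp] = Deg_dual[OF dual] HomD(1-3)[OF b] HomD(1-3)[OF d] U'
  have DegU': "Deg T U' = inv\<^bsub>G\<^esub> Deg T U"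
    using Deg_eq[of d] by (simp add: inv_equality)
  define h where "h = (d \<otimes>\<^sub>a \<iota> W) \<cdot> (\<iota> U' \<otimes>\<^sub>a e)"
  have [simp]: "h \<in> Arr T" "Dom T h = U'" "Cod T h = W" by (simp_all add: h_def)
  have x: "(\<iota> U \<otimes>\<^sub>a \<iota> U' \<otimes>\<^sub>a e) \<cdot> b = (b \<otimes>\<^sub>a \<iota> U \<otimes>\<^sub>a \<iota> W) \<cdot> e"
    using exchange[of b e] by simp
  have y: "(\<iota> U \<otimes>\<^sub>a d \<otimes>\<^sub>a \<iota> W) \<cdot> (b \<otimes>\<^sub>a \<iota> U \<otimes>\<^sub>a \<iota> W) = \<iota> U \<otimes>\<^sub>a \<iota> W"
    using arg_cong[OF z, of "\<lambda>f. f \<otimes>\<^sub>a \<iota> W"] by simp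
  have "(\<iota> U \<otimes>\<^sub>a h) \<cdot> b = (\<iota> U \<otimes>\<^sub>a d \<otimes>\<^sub>a \<iota> W) \<cdot> (b \<otimes>\<^sub>a \<iota> U \<otimes>\<^sub>a \<iota> W) \<cdot> e"
    unfolding h_def x[symmetric] by simp
  also have "\<dots> = e"
    by (subst Comp_reassoc[OF y]) (simp_all flip: Ident_TensO)
  finally have e: "e = (\<iota> U \<otimes>\<^sub>a h) \<cdot> b" by simp
  let ?a = "Deg T U"
  \<comment> \<open>The conjugate of \<open>U'\<close> has degree inverse to \<open>?a\<close>, so
    naturality acts on \<open>\<phi>\<^sub>a ?a h\<close> by that inverse and returns
    \<open>h\<close> unconjugated.\<close>
  have nat: "Twist T (\<phi>\<^sub>o ?a W) \<cdot> \<phi>\<^sub>a ?a h = h \<cdot> Twist T (\<phi>\<^sub>o ?a U')"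
    using Twist_nat[of "\<phi>\<^sub>a ?a h"] by (simp add: DegU')
  have "(\<iota> (\<phi>\<^sub>o ?a U) \<otimes>\<^sub>a Twist T (\<phi>\<^sub>o ?a W)) \<cdot> \<phi>\<^sub>a ?a e =
      (\<iota> (\<phi>\<^sub>o ?a U) \<otimes>\<^sub>a (Twist T (\<phi>\<^sub>o ?a W) \<cdot> \<phi>\<^sub>a ?a h)) \<cdot> \<phi>\<^sub>a ?a b"
    unfolding e by simp
  also have "\<dots> = (\<iota> (\<phi>\<^sub>o ?a U) \<otimes>\<^sub>a h) \<cdot> (\<iota> (\<phi>\<^sub>o ?a U) \<otimes>\<^sub>a Twist T (\<phi>\<^sub>o ?a U')) \<cdot> \<phi>\<^sub>a ?a b"
    unfolding nat by (simp add: DegU')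
  also have "\<dots> = (\<iota> (\<phi>\<^sub>o ?a U) \<otimes>\<^sub>a h) \<cdot> (Twist T U \<otimes>\<^sub>a \<iota> U') \<cdot> b"
    unfolding rib ..
  also have "\<dots> = (Twist T U \<otimes>\<^sub>a h) \<cdot> b"
    using Comp_reassoc[OF exchange(1)[of "Twist T U" h], of b] by simp
  also have "\<dots> = (Twist T U \<otimes>\<^sub>a \<iota> W) \<cdot> e"
    unfolding e using Comp_reassoc[OF exchange(2)[of "Twist T U" h], of b] by simp
  finally show ?thesis using dual by (simp add: ribbon_dual_def)
qed

end

section \<open>The ribbon equation for tensor products and for dual objects\<close>

context braided_t_category
begin

text \<open>A crossing of \<open>X\<close> with one leg of a unit equals the inverse crossing with
  the other leg, by naturality at the unit and the hexagon. Applied to \<open>bY\<close> on the left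
  side and to \<open>bX\<close> on the right side, this gives on both sides the same inverse
  crossing of \<open>X\<close> and \<open>Y'\<close>, lying between two independent units that may
  be exchanged.\<close>

lemma coev_nested_crossing:
  assumes X: "left_dual T X X' bX dX" and Y: "left_dual T Y Y' bY dY"
  shows "(Braid T X Y \<otimes>\<^sub>a \<iota> Y' \<otimes>\<^sub>a \<iota> X') \<cdot> (\<iota> X \<otimes>\<^sub>a bY \<otimes>\<^sub>a \<iota> X') \<cdot> bX =
    (\<iota> (\<phi>\<^sub>o (Deg T X) Y) \<otimes>\<^sub>a \<iota> X \<otimes>\<^sub>a Braid T X' (\<phi>\<^sub>o (Deg T X) Y')) \<cdot>
    (\<iota> (\<phi>\<^sub>o (Deg T X) Y) \<otimes>\<^sub>a bX \<otimes>\<^sub>a \<iota> (\<phi>\<^sub>o (Deg T X) Y')) \<cdot> \<phi>\<^sub>a (Deg T X) bY"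
proof -
  have [simp]: "X \<in> Obj T" "X' \<in> Obj T" "bX \<in> Arr T" "Dom T bX = \<I>" "Cod T bX = X \<otimes>\<^sub>o X'"
    "Y \<in> Obj T" "Y' \<in> Obj T" "bY \<in> Arr T" "Dom T bY = \<I>" "Cod T bY = Y \<otimes>\<^sub>o Y'"
    using assms by (simp_all add: left_dual_def Hom_def)
  note [simp] = Deg_dual[OF X] Deg_dual[OF Y]
  let ?x = "Deg T X" and ?i = "inverse_arr T (Braid T X Y')"
  have A: "(Braid T X Y \<otimes>\<^sub>a \<iota> Y') \<cdot> (\<iota> X \<otimes>\<^sub>a bY) = (\<iota> (\<phi>\<^sub>o ?x Y) \<otimes>\<^sub>a ?i) \<cdot> (\<phi>\<^sub>a ?x bY \<otimes>\<^sub>a \<iota> X)"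
  proof (rule iso_arr_cancel_left[of "\<iota> (\<phi>\<^sub>o ?x Y) \<otimes>\<^sub>a Braid T X Y'"])
    have "(\<iota> (\<phi>\<^sub>o ?x Y) \<otimes>\<^sub>a Braid T X Y') \<cdot> (\<iota> (\<phi>\<^sub>o ?x Y) \<otimes>\<^sub>a ?i) = \<iota> (\<phi>\<^sub>o ?x Y \<otimes>\<^sub>o \<phi>\<^sub>o ?x Y' \<otimes>\<^sub>o X)"
      by (simp add: interchange' del: whisker)
    from Comp_reassoc[OF this, of "\<phi>\<^sub>a ?x bY \<otimes>\<^sub>a \<iota> X"]
    show "(\<iota> (\<phi>\<^sub>o ?x Y) \<otimes>\<^sub>a Braid T X Y') \<cdot> (Braid T X Y \<otimes>\<^sub>a \<iota> Y') \<cdot> (\<iota> X \<otimes>\<^sub>a bY) =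
      (\<iota> (\<phi>\<^sub>o ?x Y) \<otimes>\<^sub>a Braid T X Y') \<cdot> (\<iota> (\<phi>\<^sub>o ?x Y) \<otimes>\<^sub>a ?i) \<cdot> (\<phi>\<^sub>a ?x bY \<otimes>\<^sub>a \<iota> X)"
      using Braid_nat[of "\<iota> X" bY] by (simp add: Braid_TensO_right del: Ident_TensO)
  qed (simp_all add: iso_arr_TensA)
  have B: "(\<iota> X \<otimes>\<^sub>a Braid T X' (\<phi>\<^sub>o ?x Y')) \<cdot> (bX \<otimes>\<^sub>a \<iota> (\<phi>\<^sub>o ?x Y')) =
      (?i \<otimes>\<^sub>a \<iota> X') \<cdot> (\<iota> (\<phi>\<^sub>o ?x Y') \<otimes>\<^sub>a bX)"
  proof (rule iso_arr_cancel_left[of "Braid T X Y' \<otimes>\<^sub>a \<iota> X'"])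
    have "(Braid T X Y' \<otimes>\<^sub>a \<iota> X') \<cdot> (?i \<otimes>\<^sub>a \<iota> X') = \<iota> (\<phi>\<^sub>o ?x Y' \<otimes>\<^sub>o X \<otimes>\<^sub>o X')"
      by (simp add: interchange' del: whisker)
    from Comp_reassoc[OF this, of "\<iota> (\<phi>\<^sub>o ?x Y') \<otimes>\<^sub>a bX"]
    show "(Braid T X Y' \<otimes>\<^sub>a \<iota> X') \<cdot> (\<iota> X \<otimes>\<^sub>a Braid T X' (\<phi>\<^sub>o ?x Y')) \<cdot> (bX \<otimes>\<^sub>a \<iota> (\<phi>\<^sub>o ?x Y')) =
      (Braid T X Y' \<otimes>\<^sub>a \<iota> X') \<cdot> (?i \<otimes>\<^sub>a \<iota> X') \<cdot> (\<iota> (\<phi>\<^sub>o ?x Y') \<otimes>\<^sub>a bX)"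
      using Braid_nat[of bX "\<iota> (\<phi>\<^sub>o ?x Y')"] by (simp add: Braid_TensO_left del: Ident_TensO)
  qed (simp_all add: iso_arr_TensA)
  have A': "(Braid T X Y \<otimes>\<^sub>a \<iota> Y' \<otimes>\<^sub>a \<iota> X') \<cdot> (\<iota> X \<otimes>\<^sub>a bY \<otimes>\<^sub>a \<iota> X') =
      (\<iota> (\<phi>\<^sub>o ?x Y) \<otimes>\<^sub>a ?i \<otimes>\<^sub>a \<iota> X') \<cdot> (\<phi>\<^sub>a ?x bY \<otimes>\<^sub>a \<iota> X \<otimes>\<^sub>a \<iota> X')"
    using arg_cong[OF A, of "\<lambda>f. f \<otimes>\<^sub>a \<iota> X'"] by simp
  have B': "(\<iota> (\<phi>\<^sub>o ?x Y) \<otimes>\<^sub>a \<iota> X \<otimes>\<^sub>a Braid T X' (\<phi>\<^sub>o ?x Y')) \<cdot> (\<iota> (\<phi>\<^sub>o ?x Y) \<otimes>\<^sub>a bX \<otimes>\<^sub>a \<iota> (\<phi>\<^sub>o ?x Y')) =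
      (\<iota> (\<phi>\<^sub>o ?x Y) \<otimes>\<^sub>a ?i \<otimes>\<^sub>a \<iota> X') \<cdot> (\<iota> (\<phi>\<^sub>o ?x Y) \<otimes>\<^sub>a \<iota> (\<phi>\<^sub>o ?x Y') \<otimes>\<^sub>a bX)"
    using arg_cong[OF B, of "\<lambda>f. \<iota> (\<phi>\<^sub>o ?x Y) \<otimes>\<^sub>a f"] by simp
  have E: "(\<phi>\<^sub>a ?x bY \<otimes>\<^sub>a \<iota> X \<otimes>\<^sub>a \<iota> X') \<cdot> bX = (\<iota> (\<phi>\<^sub>o ?x Y) \<otimes>\<^sub>a \<iota> (\<phi>\<^sub>o ?x Y') \<otimes>\<^sub>a bX) \<cdot> \<phi>\<^sub>a ?x bY"
    using exchange[of "\<phi>\<^sub>a ?x bY" bX] by simp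
  show ?thesis
    by (subst Comp_reassoc[OF A'], simp_all, subst Comp_reassoc[OF B'], simp_all add: E)
qed

end

context balanced_t_category
begin

text \<open>Naturality of the braiding, used once for each crossing, carries both twists past both
  crossings. For the dual of a tensor product the twists have to come last, since the crossings that
  slide around the arcs arrive next to the unit.\<close>

lemma Twist_TensO':
  assumes "P \<in> Obj T" "Q \<in> Obj T"
  shows "Twist T (P \<otimes>\<^sub>o Q) =
    (Twist T (\<phi>\<^sub>o (Deg T P \<otimes>\<^bsub>G\<^esub> (Deg T Q \<otimes>\<^bsub>G\<^esub> inv\<^bsub>G\<^esub> Deg T P)) P) \<otimes>\<^sub>a Twist T (\<phi>\<^sub>o (Deg T P) Q)) \<cdot>
    Braid T (\<phi>\<^sub>o (Deg T P) Q) P \<cdot> Braid T P Q"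
proof -
  note [simp] = assms
  let ?p = "Deg T P" and ?q = "Deg T Q"
  have 1: "Braid T (\<phi>\<^sub>o ?p P) (\<phi>\<^sub>o ?q Q) \<cdot> (Twist T P \<otimes>\<^sub>a Twist T Q) =
      (Twist T (\<phi>\<^sub>o ?p Q) \<otimes>\<^sub>a Twist T P) \<cdot> Braid T P Q"
    using Braid_nat[of "Twist T P" "Twist T Q"] by simp
  have 2: "Braid T (\<phi>\<^sub>o (?p \<otimes>\<^bsub>G\<^esub> ?q) Q) (\<phi>\<^sub>o ?p P) \<cdot> (Twist T (\<phi>\<^sub>o ?p Q) \<otimes>\<^sub>a Twist T P) =
      (Twist T (\<phi>\<^sub>o (?p \<otimes>\<^bsub>G\<^esub> (?q \<otimes>\<^bsub>G\<^esub> inv\<^bsub>G\<^esub> ?p)) P) \<otimes>\<^sub>a Twist T (\<phi>\<^sub>o ?p Q)) \<cdot> Braid T (\<phi>\<^sub>o ?p Q) P"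
    using Braid_nat[of "Twist T (\<phi>\<^sub>o ?p Q)" "Twist T P"] by simp
  show ?thesis
    using Comp_reassoc[OF 2, of "Braid T P Q"] by (simp add: Twist_TensO 1)
qed

text \<open>
  For the left dual \<open>V\<^sup>* \<otimes> U\<^sup>*\<close> with the nested unit, the two crossings in \<open>\<theta>\<^bsub>U \<otimes> V\<^esub>\<close> slide along
  the nested arcs to the two crossings in \<open>\<theta>\<^bsub>V\<^sup>* \<otimes> U\<^sup>*\<^esub>\<close>.
\<close>

lemma ribbon_dual_TensO:
  assumes U: "ribbon_dual G T U U' b d" and V: "ribbon_dual G T V V' e f"
    and W: "left_dual T (U \<otimes>\<^sub>o V) W g h"
  shows "ribbon_dual G T (U \<otimes>\<^sub>o V) W g h"
proof -
  note [simp] = ribbon_dualD(2-10)[OF U] ribbon_dualD(2-10)[OF V]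
  define a where "a = Deg T U"
  define c where "c = Deg T V"
  have [simp]: "Deg T U = a" "a \<in> carrier G" "Deg T V = c" "c \<in> carrier G"
    by (simp_all add: a_def c_def)
  define B where "B = (\<iota> U \<otimes>\<^sub>a e \<otimes>\<^sub>a \<iota> U') \<cdot> b"
  define D where "D = f \<cdot> (\<iota> V' \<otimes>\<^sub>a d \<otimes>\<^sub>a \<iota> V)"
  have "(\<iota> U \<otimes>\<^sub>a \<iota> V \<otimes>\<^sub>a D) \<cdot> (B \<otimes>\<^sub>a \<iota> U \<otimes>\<^sub>a \<iota> V) = \<iota> U \<otimes>\<^sub>a \<iota> V"
  proof -
    \<comment> \<open>\<open>e\<close> and \<open>d\<close> live on disjoint strands. Once their
      order is exchanged, the strands \<open>U\<close> and \<open>V\<close> straighten one after the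
      other.\<close>
    have x: "(\<iota> U \<otimes>\<^sub>a \<iota> V \<otimes>\<^sub>a \<iota> V' \<otimes>\<^sub>a d \<otimes>\<^sub>a \<iota> V) \<cdot> (\<iota> U \<otimes>\<^sub>a e \<otimes>\<^sub>a \<iota> U' \<otimes>\<^sub>a \<iota> U \<otimes>\<^sub>a \<iota> V) =
        (\<iota> U \<otimes>\<^sub>a e \<otimes>\<^sub>a \<iota> V) \<cdot> (\<iota> U \<otimes>\<^sub>a d \<otimes>\<^sub>a \<iota> V)"
      using arg_cong[OF exchange(1)[of e d], of "\<lambda>f. \<iota> U \<otimes>\<^sub>a f \<otimes>\<^sub>a \<iota> V"]
        arg_cong[OF exchange(2)[of e d], of "\<lambda>f. \<iota> U \<otimes>\<^sub>a f \<otimes>\<^sub>a \<iota> V"] by simp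
    have y: "(\<iota> U \<otimes>\<^sub>a d \<otimes>\<^sub>a \<iota> V) \<cdot> (b \<otimes>\<^sub>a \<iota> U \<otimes>\<^sub>a \<iota> V) = \<iota> U \<otimes>\<^sub>a \<iota> V"
      using arg_cong[OF ribbon_dualD(11)[OF U], of "\<lambda>f. f \<otimes>\<^sub>a \<iota> V"] by simp
    have z: "(\<iota> U \<otimes>\<^sub>a \<iota> V \<otimes>\<^sub>a f) \<cdot> (\<iota> U \<otimes>\<^sub>a e \<otimes>\<^sub>a \<iota> V) = \<iota> U \<otimes>\<^sub>a \<iota> V"
      using arg_cong[OF ribbon_dualD(11)[OF V], of "\<lambda>f. \<iota> U \<otimes>\<^sub>a f"] by simp
    have "(\<iota> U \<otimes>\<^sub>a \<iota> V \<otimes>\<^sub>a D) \<cdot> (B \<otimes>\<^sub>a \<iota> U \<otimes>\<^sub>a \<iota> V) = (\<iota> U \<otimes>\<^sub>a \<iota> V \<otimes>\<^sub>a f) \<cdot>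
        ((\<iota> U \<otimes>\<^sub>a \<iota> V \<otimes>\<^sub>a \<iota> V' \<otimes>\<^sub>a d \<otimes>\<^sub>a \<iota> V) \<cdot> (\<iota> U \<otimes>\<^sub>a e \<otimes>\<^sub>a \<iota> U' \<otimes>\<^sub>a \<iota> U \<otimes>\<^sub>a \<iota> V)) \<cdot>
        (b \<otimes>\<^sub>a \<iota> U \<otimes>\<^sub>a \<iota> V)"
      using whisker(2)[of "U \<otimes>\<^sub>o V" b "\<iota> U \<otimes>\<^sub>a e \<otimes>\<^sub>a \<iota> U'"] by (simp add: B_def D_def)
    also have "\<dots> = \<iota> U \<otimes>\<^sub>a \<iota> V"
      unfolding x using Comp_Ident(2)[of "\<iota> U \<otimes>\<^sub>a e \<otimes>\<^sub>a \<iota> V" "U \<otimes>\<^sub>o V"] by (simp add: y z)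
    finally show ?thesis .
  qed
  moreover have "(\<iota> (\<phi>\<^sub>o (a \<otimes>\<^bsub>G\<^esub> c) U) \<otimes>\<^sub>a \<iota> (\<phi>\<^sub>o (a \<otimes>\<^bsub>G\<^esub> c) V) \<otimes>\<^sub>a
        Twist T (\<phi>\<^sub>o (a \<otimes>\<^bsub>G\<^esub> c) V' \<otimes>\<^sub>o \<phi>\<^sub>o (a \<otimes>\<^bsub>G\<^esub> c) U')) \<cdot> \<phi>\<^sub>a (a \<otimes>\<^bsub>G\<^esub> c) B =
      (Twist T (U \<otimes>\<^sub>o V) \<otimes>\<^sub>a \<iota> V' \<otimes>\<^sub>a \<iota> U') \<cdot> B"
  proof -
    let ?g = "a \<otimes>\<^bsub>G\<^esub> c"
    let ?aU = "\<phi>\<^sub>o a U" and ?aU' = "\<phi>\<^sub>o a U'" and ?cV = "\<phi>\<^sub>o c V" and ?cV' = "\<phi>\<^sub>o c V'"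
    let ?gU = "\<phi>\<^sub>o ?g U" and ?gU' = "\<phi>\<^sub>o ?g U'" and ?gV = "\<phi>\<^sub>o ?g V" and ?gV' = "\<phi>\<^sub>o ?g V'"
    let ?ab = "\<phi>\<^sub>a a b" and ?ce = "\<phi>\<^sub>a c e" and ?gb = "\<phi>\<^sub>a ?g b" and ?ge = "\<phi>\<^sub>a ?g e"
    let ?t = "Twist T ?cV' \<otimes>\<^sub>a Twist T ?aU'"
    have rU: "(\<iota> ?aU \<otimes>\<^sub>a Twist T ?aU') \<cdot> ?ab = (Twist T U \<otimes>\<^sub>a \<iota> U') \<cdot> b"
      using ribbon_dualD(13)[OF U] by simp
    have rV: "(\<iota> ?cV \<otimes>\<^sub>a Twist T ?cV') \<cdot> ?ce = (Twist T V \<otimes>\<^sub>a \<iota> V') \<cdot> e"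
      using ribbon_dualD(13)[OF V] by simp
    \<comment> \<open>The first crossing turns the nesting inside out, leaving the unit of
      \<open>V\<close> outermost and conjugated by \<open>?g\<close>. In the second,
      \<open>?gV\<close> has degree \<open>a\<close> times \<open>c\<close> times the inverse of
      \<open>a\<close>, which takes \<open>?aU\<close> to \<open>?gU\<close>; the original nesting
      returns with both units conjugated by \<open>?g\<close>.\<close>
    have c1: "(Braid T ?aU ?cV \<otimes>\<^sub>a \<iota> ?cV' \<otimes>\<^sub>a \<iota> ?aU') \<cdot> (\<iota> ?aU \<otimes>\<^sub>a ?ce \<otimes>\<^sub>a \<iota> ?aU') \<cdot> ?ab =
        (\<iota> ?gV \<otimes>\<^sub>a \<iota> ?aU \<otimes>\<^sub>a Braid T ?aU' ?gV') \<cdot> (\<iota> ?gV \<otimes>\<^sub>a ?ab \<otimes>\<^sub>a \<iota> ?gV') \<cdot> ?ge"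
      using coev_nested_crossing[OF left_dual_Act[OF ribbon_dualD(1)[OF U], of a]
        left_dual_Act[OF ribbon_dualD(1)[OF V], of c]] by simp
    have c2: "(Braid T ?gV ?aU \<otimes>\<^sub>a \<iota> ?aU' \<otimes>\<^sub>a \<iota> ?gV') \<cdot> (\<iota> ?gV \<otimes>\<^sub>a ?ab \<otimes>\<^sub>a \<iota> ?gV') \<cdot> ?ge =
        (\<iota> ?gU \<otimes>\<^sub>a \<iota> ?gV \<otimes>\<^sub>a Braid T ?gV' ?gU') \<cdot> (\<iota> ?gU \<otimes>\<^sub>a ?ge \<otimes>\<^sub>a \<iota> ?gU') \<cdot> ?gb"
      using coev_nested_crossing[OF left_dual_Act[OF ribbon_dualD(1)[OF V], of ?g]
        left_dual_Act[OF ribbon_dualD(1)[OF U], of a]] by simp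
    \<comment> \<open>The ribbon equations of \<open>V\<close> and \<open>U\<close> move both twists
      from the left legs of the nested arcs to the right legs, at the price of conjugating the inner
      arc by \<open>c\<close> and the outer one by \<open>a\<close>.\<close>
    have t1: "(Twist T U \<otimes>\<^sub>a Twist T V \<otimes>\<^sub>a \<iota> V' \<otimes>\<^sub>a \<iota> U') \<cdot> B =
        (\<iota> ?aU \<otimes>\<^sub>a \<iota> ?cV \<otimes>\<^sub>a ?t) \<cdot> (\<iota> ?aU \<otimes>\<^sub>a ?ce \<otimes>\<^sub>a \<iota> ?aU') \<cdot> ?ab"
    proof -
      define k where "k = (Twist T V \<otimes>\<^sub>a \<iota> V') \<cdot> e"
      have k [simp]: "k \<in> Arr T" "Dom T k = \<I>" "Cod T k = ?cV \<otimes>\<^sub>o V'" by (simp_all add: k_def)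
      have "(Twist T U \<otimes>\<^sub>a Twist T V \<otimes>\<^sub>a \<iota> V' \<otimes>\<^sub>a \<iota> U') \<cdot> B =
          (Twist T U \<otimes>\<^sub>a \<iota> ?cV \<otimes>\<^sub>a \<iota> V' \<otimes>\<^sub>a \<iota> U') \<cdot> (\<iota> U \<otimes>\<^sub>a k \<otimes>\<^sub>a \<iota> U') \<cdot> b"
        using Comp_reassoc[OF exchange(2)[of "Twist T U" "Twist T V \<otimes>\<^sub>a \<iota> V' \<otimes>\<^sub>a \<iota> U'"], of B]
        by (simp add: k_def B_def)
      also have "\<dots> = (\<iota> ?aU \<otimes>\<^sub>a k \<otimes>\<^sub>a \<iota> U') \<cdot> (Twist T U \<otimes>\<^sub>a \<iota> U') \<cdot> b"
        using Comp_reassoc[OF exchange(1)[of "Twist T U" "k \<otimes>\<^sub>a \<iota> U'"], of b]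
          Comp_reassoc[OF exchange(2)[of "Twist T U" "k \<otimes>\<^sub>a \<iota> U'"], of b] by simp
      also have "\<dots> = (\<iota> ?aU \<otimes>\<^sub>a ((k \<otimes>\<^sub>a \<iota> U') \<cdot> Twist T ?aU')) \<cdot> ?ab"
        unfolding rU[symmetric] by simp
      also have "(k \<otimes>\<^sub>a \<iota> U') \<cdot> Twist T ?aU' = k \<otimes>\<^sub>a Twist T ?aU'"
        using exchange(2)[of k "Twist T ?aU'"] by simp
      also have "\<dots> = (\<iota> ?cV \<otimes>\<^sub>a ?t) \<cdot> (?ce \<otimes>\<^sub>a \<iota> ?aU')"
        using interchange'[of ?ce "\<iota> ?cV \<otimes>\<^sub>a Twist T ?cV'" "\<iota> ?aU'" "Twist T ?aU'"] rV
        by (simp add: k_def)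
      finally show ?thesis by simp
    qed
    have e1: "(Braid T ?aU ?cV \<otimes>\<^sub>a \<iota> V' \<otimes>\<^sub>a \<iota> U') \<cdot> (\<iota> ?aU \<otimes>\<^sub>a \<iota> ?cV \<otimes>\<^sub>a ?t) =
        (\<iota> ?gV \<otimes>\<^sub>a \<iota> ?aU \<otimes>\<^sub>a ?t) \<cdot> (Braid T ?aU ?cV \<otimes>\<^sub>a \<iota> ?cV' \<otimes>\<^sub>a \<iota> ?aU')"
      using exchange[of "Braid T ?aU ?cV" ?t] by simp
    have e2: "(Braid T ?gV ?aU \<otimes>\<^sub>a \<iota> V' \<otimes>\<^sub>a \<iota> U') \<cdot> (\<iota> ?gV \<otimes>\<^sub>a \<iota> ?aU \<otimes>\<^sub>a (?t \<cdot> Braid T ?aU' ?gV')) =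
        (\<iota> ?gU \<otimes>\<^sub>a \<iota> ?gV \<otimes>\<^sub>a (?t \<cdot> Braid T ?aU' ?gV')) \<cdot> (Braid T ?gV ?aU \<otimes>\<^sub>a \<iota> ?aU' \<otimes>\<^sub>a \<iota> ?gV')"
      using exchange[of "Braid T ?gV ?aU" "?t \<cdot> Braid T ?aU' ?gV'"] by simp
    have "(Twist T (U \<otimes>\<^sub>o V) \<otimes>\<^sub>a \<iota> V' \<otimes>\<^sub>a \<iota> U') \<cdot> B =
        (Braid T ?gV ?aU \<otimes>\<^sub>a \<iota> V' \<otimes>\<^sub>a \<iota> U') \<cdot> (Braid T ?aU ?cV \<otimes>\<^sub>a \<iota> V' \<otimes>\<^sub>a \<iota> U') \<cdot>
        (Twist T U \<otimes>\<^sub>a Twist T V \<otimes>\<^sub>a \<iota> V' \<otimes>\<^sub>a \<iota> U') \<cdot> B"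
      by (simp add: Twist_TensO interchange' B_def flip: Ident_TensO)
    also have "\<dots> = (Braid T ?gV ?aU \<otimes>\<^sub>a \<iota> V' \<otimes>\<^sub>a \<iota> U') \<cdot> (\<iota> ?gV \<otimes>\<^sub>a \<iota> ?aU \<otimes>\<^sub>a ?t) \<cdot>
        (Braid T ?aU ?cV \<otimes>\<^sub>a \<iota> ?cV' \<otimes>\<^sub>a \<iota> ?aU') \<cdot> (\<iota> ?aU \<otimes>\<^sub>a ?ce \<otimes>\<^sub>a \<iota> ?aU') \<cdot> ?ab"
      unfolding t1 by (subst Comp_reassoc[OF e1]) simp_all
    also have "\<dots> = (Braid T ?gV ?aU \<otimes>\<^sub>a \<iota> V' \<otimes>\<^sub>a \<iota> U') \<cdot>
        (\<iota> ?gV \<otimes>\<^sub>a \<iota> ?aU \<otimes>\<^sub>a (?t \<cdot> Braid T ?aU' ?gV')) \<cdot> (\<iota> ?gV \<otimes>\<^sub>a ?ab \<otimes>\<^sub>a \<iota> ?gV') \<cdot> ?ge"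
      unfolding c1 by simp
    also have "\<dots> = (\<iota> ?gU \<otimes>\<^sub>a \<iota> ?gV \<otimes>\<^sub>a (?t \<cdot> Braid T ?aU' ?gV')) \<cdot>
        (Braid T ?gV ?aU \<otimes>\<^sub>a \<iota> ?aU' \<otimes>\<^sub>a \<iota> ?gV') \<cdot> (\<iota> ?gV \<otimes>\<^sub>a ?ab \<otimes>\<^sub>a \<iota> ?gV') \<cdot> ?ge"
      by (subst Comp_reassoc[OF e2]) simp_all
    also have "\<dots> = (\<iota> ?gU \<otimes>\<^sub>a \<iota> ?gV \<otimes>\<^sub>a (?t \<cdot> Braid T ?aU' ?gV')) \<cdot>
        (\<iota> ?gU \<otimes>\<^sub>a \<iota> ?gV \<otimes>\<^sub>a Braid T ?gV' ?gU') \<cdot> \<phi>\<^sub>a ?g B"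
      unfolding c2 by (simp add: B_def)
    also have "\<dots> = (\<iota> ?gU \<otimes>\<^sub>a \<iota> ?gV \<otimes>\<^sub>a Twist T (?gV' \<otimes>\<^sub>o ?gU')) \<cdot> \<phi>\<^sub>a ?g B"
      by (simp add: Twist_TensO' B_def)
    finally show ?thesis ..
  qed
  ultimately show ?thesis
    by (intro ribbon_dual_change[OF W, of B "V' \<otimes>\<^sub>o U'" D]) (simp_all add: Hom_def B_def D_def)
qed

text \<open>
  Writing \<open>\<alpha>\<close> for the degree of \<open>U\<close>, the object \<open>\<phi>\<^bsub>inv \<alpha>\<^esub> U\<close> is a left dual of \<open>U\<^sup>*\<close>, with unit the
  conjugate of \<open>c\<^bsub>U,U\<^sup>*\<^esub> b\<^sub>U\<close> and counit \<open>d\<^sub>U\<close> after the inverse of \<open>c\<^bsub>U\<^sup>*,U\<^esub>\<close>.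
\<close>

lemma ribbon_dual_Star:
  assumes U: "ribbon_dual G T U U' b d" and W: "left_dual T U' W g h"
  shows "ribbon_dual G T U' W g h"
proof -
  note [simp] = ribbon_dualD(2-10)[OF U]
  define a where "a = Deg T U"
  have [simp]: "Deg T U = a" "a \<in> carrier G" by (simp_all add: a_def)
  define X where "X = \<phi>\<^sub>o (inv\<^bsub>G\<^esub> a) U"
  define X' where "X' = \<phi>\<^sub>o (inv\<^bsub>G\<^esub> a) U'"
  define bX where "bX = \<phi>\<^sub>a (inv\<^bsub>G\<^esub> a) b"
  have [simp]: "X \<in> Obj T" "X' \<in> Obj T" "bX \<in> Arr T" "Dom T bX = \<I>" "Cod T bX = X \<otimes>\<^sub>o X'"
    "Deg T X = a" "Deg T X' = inv\<^bsub>G\<^esub> a" "\<phi>\<^sub>o a X = U" "\<phi>\<^sub>o a X' = U'"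
    "\<phi>\<^sub>o (inv\<^bsub>G\<^esub> a) U = X" "\<phi>\<^sub>o (inv\<^bsub>G\<^esub> a) U' = X'" "\<phi>\<^sub>a (inv\<^bsub>G\<^esub> a) b = bX" "\<phi>\<^sub>a a bX = b"
    by (simp_all add: X_def X'_def bX_def)
  define B where "B = Braid T X X' \<cdot> bX"
  define c where "c = Braid T U' U"
  let ?i = "inverse_arr T c"
  have [simp]: "c \<in> Arr T" "Dom T c = U' \<otimes>\<^sub>o U" "Cod T c = X \<otimes>\<^sub>o U'" "iso_arr T c"
    by (simp_all add: c_def)
  have [simp]: "B \<in> Arr T" "Dom T B = \<I>" "Cod T B = U' \<otimes>\<^sub>o X"
    by (simp_all add: B_def)
  have "(\<iota> U' \<otimes>\<^sub>a (d \<cdot> ?i)) \<cdot> (B \<otimes>\<^sub>a \<iota> U') = \<iota> U'"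
  proof -
    let ?C = "Braid T (U' \<otimes>\<^sub>o U) U'"
    \<comment> \<open>Braiding \<open>U'\<close> past all of \<open>b\<close> conjugates
      \<open>b\<close> into \<open>bX\<close>. The crossings then assemble into the braiding of
      \<open>X \<otimes>\<^sub>o U'\<close> with \<open>U'\<close>, and naturality at
      \<open>c\<close> and at \<open>d\<close> leaves a triangle identity on
      \<open>U'\<close>.\<close>
    have 1: "bX \<otimes>\<^sub>a \<iota> U' = (\<iota> X \<otimes>\<^sub>a Braid T U' U') \<cdot> (c \<otimes>\<^sub>a \<iota> U') \<cdot> (\<iota> U' \<otimes>\<^sub>a b)"
      using Braid_nat[of "\<iota> U'" b] by (simp add: Braid_TensO_right c_def)
    have 2: "(Braid T X X' \<otimes>\<^sub>a \<iota> U') \<cdot> (\<iota> X \<otimes>\<^sub>a Braid T U' U') = Braid T (X \<otimes>\<^sub>o U') U'"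
      by (simp add: Braid_TensO_left)
    have 3: "Braid T (X \<otimes>\<^sub>o U') U' \<cdot> (c \<otimes>\<^sub>a \<iota> U') = (\<iota> U' \<otimes>\<^sub>a c) \<cdot> ?C"
      using Braid_nat[of c "\<iota> U'"] by simp
    have 4: "(\<iota> U' \<otimes>\<^sub>a d) \<cdot> ?C = d \<otimes>\<^sub>a \<iota> U'"
      using Braid_nat[of d "\<iota> U'"] by simp
    have 5: "(\<iota> U' \<otimes>\<^sub>a ?i) \<cdot> (\<iota> U' \<otimes>\<^sub>a c) = \<iota> U' \<otimes>\<^sub>a \<iota> U' \<otimes>\<^sub>a \<iota> U"
      by (simp add: interchange' del: whisker)
    have 6: "(\<iota> U' \<otimes>\<^sub>a ?i) \<cdot> (\<iota> U' \<otimes>\<^sub>a c) \<cdot> ?C = ?C"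
      by (subst Comp_reassoc[OF 5]) (simp_all flip: Ident_TensO)
    have "(B \<otimes>\<^sub>a \<iota> U') = (Braid T X X' \<otimes>\<^sub>a \<iota> U') \<cdot> (bX \<otimes>\<^sub>a \<iota> U')"
      by (simp add: B_def)
    also have "\<dots> = Braid T (X \<otimes>\<^sub>o U') U' \<cdot> (c \<otimes>\<^sub>a \<iota> U') \<cdot> (\<iota> U' \<otimes>\<^sub>a b)"
      unfolding 1 by (subst Comp_reassoc[OF 2]) simp_all
    also have "\<dots> = (\<iota> U' \<otimes>\<^sub>a c) \<cdot> ?C \<cdot> (\<iota> U' \<otimes>\<^sub>a b)"
      by (subst Comp_reassoc[OF 3]) simp_all
    finally have "(\<iota> U' \<otimes>\<^sub>a (d \<cdot> ?i)) \<cdot> (B \<otimes>\<^sub>a \<iota> U') =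
        (\<iota> U' \<otimes>\<^sub>a d) \<cdot> ((\<iota> U' \<otimes>\<^sub>a ?i) \<cdot> (\<iota> U' \<otimes>\<^sub>a c) \<cdot> ?C) \<cdot> (\<iota> U' \<otimes>\<^sub>a b)"
      by simp
    also have "\<dots> = (d \<otimes>\<^sub>a \<iota> U') \<cdot> (\<iota> U' \<otimes>\<^sub>a b)"
      unfolding 6 by (subst Comp_reassoc[OF 4]) simp_all
    finally show ?thesis using ribbon_dualD(12)[OF U] by simp
  qed
  moreover have "(\<iota> X' \<otimes>\<^sub>a Twist T (\<phi>\<^sub>o (inv\<^bsub>G\<^esub> a) X)) \<cdot> \<phi>\<^sub>a (inv\<^bsub>G\<^esub> a) B = (Twist T U' \<otimes>\<^sub>a \<iota> X) \<cdot> B"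
  proof -
    define Y where "Y = \<phi>\<^sub>o (inv\<^bsub>G\<^esub> a) X"
    define Y' where "Y' = \<phi>\<^sub>o (inv\<^bsub>G\<^esub> a) X'"
    define bY where "bY = \<phi>\<^sub>a (inv\<^bsub>G\<^esub> a) bX"
    have [simp]: "Y \<in> Obj T" "Y' \<in> Obj T" "bY \<in> Arr T" "Dom T bY = \<I>" "Cod T bY = Y \<otimes>\<^sub>o Y'"
      "Deg T Y = a" "\<phi>\<^sub>o a Y = X" "\<phi>\<^sub>o a Y' = X'" "\<phi>\<^sub>a a bY = bX" "\<phi>\<^sub>o (inv\<^bsub>G\<^esub> a) X = Y"
      "\<phi>\<^sub>o (inv\<^bsub>G\<^esub> a) X' = Y'" "\<phi>\<^sub>a (inv\<^bsub>G\<^esub> a) bX = bY"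
      by (simp_all add: Y_def Y'_def bY_def del: Act_mult) (simp_all)
    \<comment> \<open>The ribbon equation is conjugated twice, since the twist of \<open>U'\<close>
      slides back through the crossing as the twist of \<open>X'\<close>, is traded for the twist of
      \<open>Y\<close>, and slides forward again on the other strand.\<close>
    have rY: "(\<iota> X \<otimes>\<^sub>a Twist T X') \<cdot> bX = (Twist T Y \<otimes>\<^sub>a \<iota> Y') \<cdot> bY"
      using ribbon_dualD(13)[OF ribbon_dual_Act[OF ribbon_dual_Act[OF U, of "inv\<^bsub>G\<^esub> a"], of "inv\<^bsub>G\<^esub> a"]]
      by (simp del: Act_mult)
    have 1: "(Twist T U' \<otimes>\<^sub>a \<iota> X) \<cdot> Braid T X X' = Braid T X Y' \<cdot> (\<iota> X \<otimes>\<^sub>a Twist T X')"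
      using Braid_nat[of "\<iota> X" "Twist T X'"] by simp
    have 2: "Braid T X Y' \<cdot> (Twist T Y \<otimes>\<^sub>a \<iota> Y') = (\<iota> X' \<otimes>\<^sub>a Twist T Y) \<cdot> Braid T Y Y'"
      using Braid_nat[of "Twist T Y" "\<iota> Y'"] by simp
    have "(Twist T U' \<otimes>\<^sub>a \<iota> X) \<cdot> B = Braid T X Y' \<cdot> (\<iota> X \<otimes>\<^sub>a Twist T X') \<cdot> bX"
      unfolding B_def by (subst Comp_reassoc[OF 1]) simp_all
    also have "\<dots> = (\<iota> X' \<otimes>\<^sub>a Twist T Y) \<cdot> Braid T Y Y' \<cdot> bY"
      unfolding rY by (subst Comp_reassoc[OF 2]) simp_all
    finally show ?thesis by (simp add: B_def)
  qed
  ultimately show ?thesis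
    by (intro ribbon_dual_change[OF W, of B X "d \<cdot> ?i"]) (simp_all add: Hom_def)
qed

lemma good_left_dual_TUnit: "good_left_dual G T \<I> \<I> (\<iota> \<I>) (\<iota> \<I>)"
  by (simp add: good_left_dual_iff stable_left_dual_def ribbon_dual_def left_dual_def Hom_def)

end

section \<open>Full subcategories and the choice of good duals\<close>

abbreviation full_sub :: "('g, 'o, 'a, 'm) balanced_t_cat_scheme \<Rightarrow> 'o set \<Rightarrow>
    ('g, 'o, 'a, 'm) balanced_t_cat_scheme" where
  "full_sub T X \<equiv> T\<lparr>Obj := X, Arr := {f \<in> Arr T. Dom T f \<in> X \<and> Cod T f \<in> X}\<rparr>"

context balanced_t_category
begin

lemma Hom_full_sub:
  "f \<in> Hom (full_sub T X) U V \<longleftrightarrow> f \<in> Hom T U V \<and> U \<in> X \<and> V \<in> X"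
  by (auto simp: Hom_def)

lemma iso_arr_full_sub:
  assumes "iso_arr T f" "Dom T f \<in> X" "Cod T f \<in> X"
  shows "iso_arr (full_sub T X) f"
proof -
  have "inverse_arr T f \<in> Hom (full_sub T X) (Cod T f) (Dom T f)"
    using assms by (simp add: Hom_def)
  moreover have "inverse_arr T f \<cdot> f = \<iota> (Dom T f) \<and> f \<cdot> inverse_arr T f = \<iota> (Cod T f)"
    using assms by simp
  ultimately show ?thesis
    using iso_arr_inverse(1)[OF assms(1)] assms(2,3) by (simp add: iso_arr_def) blast
qed

lemma strict_tensor_aut_full_sub:
  assumes X: "X \<subseteq> Obj T" and Act: "\<And>\<beta> U. \<beta> \<in> carrier G \<Longrightarrow> U \<in> X \<Longrightarrow> \<phi>\<^sub>o \<beta> U \<in> X"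
    and \<beta>: "\<beta> \<in> carrier G"
  shows "strict_tensor_aut (full_sub T X) (\<phi>\<^sub>o \<beta>) (\<phi>\<^sub>a \<beta>)"
proof -
  let ?S = "full_sub T X"
  have inj: "inj_on (\<phi>\<^sub>o \<beta>) (Obj T)" "inj_on (\<phi>\<^sub>a \<beta>) (Arr T)"
    using Act_aut[OF \<beta>] by (auto simp: strict_tensor_aut_def bij_betw_def)
  have XD: "U \<in> X \<Longrightarrow> U \<in> Obj T" for U using X by blast
  have o: "bij_betw (\<phi>\<^sub>o \<beta>) (Obj ?S) (Obj ?S)"
  proof (rule bij_betw_imageI)
    show "inj_on (\<phi>\<^sub>o \<beta>) (Obj ?S)" using inj(1) X by (simp add: inj_on_subset)
    show "\<phi>\<^sub>o \<beta> ` Obj ?S = Obj ?S"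
    proof
      show "\<phi>\<^sub>o \<beta> ` Obj ?S \<subseteq> Obj ?S" using Act \<beta> by auto
      show "Obj ?S \<subseteq> \<phi>\<^sub>o \<beta> ` Obj ?S"
      proof
        fix U assume "U \<in> Obj ?S"
        then have "\<phi>\<^sub>o (inv\<^bsub>G\<^esub> \<beta>) U \<in> Obj ?S" "U = \<phi>\<^sub>o \<beta> (\<phi>\<^sub>o (inv\<^bsub>G\<^esub> \<beta>) U)"
          using Act[of "inv\<^bsub>G\<^esub> \<beta>" U] \<beta> XD[of U] by simp_all
        then show "U \<in> \<phi>\<^sub>o \<beta> ` Obj ?S" by blast
      qed
    qed
  qed
  have a: "bij_betw (\<phi>\<^sub>a \<beta>) (Arr ?S) (Arr ?S)"
  proof (rule bij_betw_imageI)
    show "inj_on (\<phi>\<^sub>a \<beta>) (Arr ?S)" by (rule inj_on_subset[OF inj(2)]) auto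
    show "\<phi>\<^sub>a \<beta> ` Arr ?S = Arr ?S"
    proof
      show "\<phi>\<^sub>a \<beta> ` Arr ?S \<subseteq> Arr ?S" using Act \<beta> by auto
      show "Arr ?S \<subseteq> \<phi>\<^sub>a \<beta> ` Arr ?S"
      proof
        fix f assume "f \<in> Arr ?S"
        then have "\<phi>\<^sub>a (inv\<^bsub>G\<^esub> \<beta>) f \<in> Arr ?S" "f = \<phi>\<^sub>a \<beta> (\<phi>\<^sub>a (inv\<^bsub>G\<^esub> \<beta>) f)"
          using Act[of "inv\<^bsub>G\<^esub> \<beta>"] \<beta> by simp_all
        then show "f \<in> \<phi>\<^sub>a \<beta> ` Arr ?S" by blast
      qed
    qed
  qed
  have comp: "\<phi>\<^sub>a \<beta> (h \<cdot> g) = \<phi>\<^sub>a \<beta> h \<cdot> \<phi>\<^sub>a \<beta> g" if "g \<in> Hom T U V" "h \<in> Hom T V W" for g h U V W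
    using that \<beta> by (simp add: Hom_def)
  show ?thesis
    using o a Act_aut[OF \<beta>] Act[OF \<beta>] XD
    unfolding strict_tensor_aut_def Ball_def Hom_full_sub by simp (use comp in blast)
qed

text \<open>Closure has to be checked on objects only: the subcategory is full, so it contains the
  braidings, the twists and their inverses as soon as it contains their domains and
  codomains.\<close>

lemma balanced_full_sub:
  assumes X: "X \<subseteq> Obj T" and unit: "\<I> \<in> X"
    and tens: "\<And>U V. U \<in> X \<Longrightarrow> V \<in> X \<Longrightarrow> U \<otimes>\<^sub>o V \<in> X"
    and Act: "\<And>\<beta> U. \<beta> \<in> carrier G \<Longrightarrow> U \<in> X \<Longrightarrow> \<phi>\<^sub>o \<beta> U \<in> X"
  shows "balanced_t_category G (full_sub T X)"
proof -
  let ?S = "full_sub T X"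
  have XD [simp]: "U \<in> X \<Longrightarrow> U \<in> Obj T" for U using X by blast
  interpret S: category ?S
  proof
    show "\<iota>\<^bsub>?S\<^esub> U \<in> Hom ?S U U" if "U \<in> Obj ?S" for U
      using that Ident_Hom[of U] by (simp add: Hom_full_sub)
    show "g \<cdot>\<^bsub>?S\<^esub> f \<in> Hom ?S U W" if "f \<in> Hom ?S U V" "g \<in> Hom ?S V W" for f g U V W
      using that Comp_Hom[of f U V g W] by (simp add: Hom_full_sub)
    show "(h \<cdot>\<^bsub>?S\<^esub> g) \<cdot>\<^bsub>?S\<^esub> f = h \<cdot>\<^bsub>?S\<^esub> (g \<cdot>\<^bsub>?S\<^esub> f)"
      if "f \<in> Hom ?S U V" "g \<in> Hom ?S V W" "h \<in> Hom ?S W Y" for f g h U V W Y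
      using that Comp_assoc[of f U V g W h Y] by (simp add: Hom_full_sub)
  qed (simp_all add: Hom_def)
  interpret S: strict_tensor_category ?S
  proof
    show "f \<otimes>\<^sub>a\<^bsub>?S\<^esub> g \<in> Hom ?S (U \<otimes>\<^sub>o\<^bsub>?S\<^esub> V) (U' \<otimes>\<^sub>o\<^bsub>?S\<^esub> V')"
      if "f \<in> Hom ?S U U'" "g \<in> Hom ?S V V'" for f g U U' V V'
      using that TensA_Hom[of f U U' g V V'] tens by (simp add: Hom_full_sub)
    show "(g \<cdot>\<^bsub>?S\<^esub> f) \<otimes>\<^sub>a\<^bsub>?S\<^esub> (g' \<cdot>\<^bsub>?S\<^esub> f') = (g \<otimes>\<^sub>a\<^bsub>?S\<^esub> g') \<cdot>\<^bsub>?S\<^esub> (f \<otimes>\<^sub>a\<^bsub>?S\<^esub> f')"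
      if "f \<in> Hom ?S U V" "g \<in> Hom ?S V W" "f' \<in> Hom ?S U' V'" "g' \<in> Hom ?S V' W'"
      for f g f' g' U V W U' V' W'
      using that interchange[of f U V g W f' U' V' g' W'] by (simp add: Hom_full_sub)
  qed (use unit tens in simp_all)
  interpret S: t_category G ?S
  proof
    show "Deg ?S U = Deg ?S V" if "f \<in> Hom ?S U V" for f U V
      using that Deg_Hom[of f U V] by (simp add: Hom_full_sub)
    show "strict_tensor_aut ?S (\<phi>\<^sub>o\<^bsub>?S\<^esub> \<beta>) (\<phi>\<^sub>a\<^bsub>?S\<^esub> \<beta>)" if "\<beta> \<in> carrier G" for \<beta>
      using strict_tensor_aut_full_sub[OF X Act that] by simp
    show "\<phi>\<^sub>o\<^bsub>?S\<^esub> \<beta> ` component ?S \<alpha> = component ?S (\<beta> \<otimes>\<^bsub>G\<^esub> \<alpha> \<otimes>\<^bsub>G\<^esub> inv\<^bsub>G\<^esub> \<beta>)"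
      if [simp]: "\<alpha> \<in> carrier G" "\<beta> \<in> carrier G" for \<alpha> \<beta>
    proof
      show "\<phi>\<^sub>o\<^bsub>?S\<^esub> \<beta> ` component ?S \<alpha> \<subseteq> component ?S (\<beta> \<otimes>\<^bsub>G\<^esub> \<alpha> \<otimes>\<^bsub>G\<^esub> inv\<^bsub>G\<^esub> \<beta>)"
        using Act by (auto simp: component_def)
      show "component ?S (\<beta> \<otimes>\<^bsub>G\<^esub> \<alpha> \<otimes>\<^bsub>G\<^esub> inv\<^bsub>G\<^esub> \<beta>) \<subseteq> \<phi>\<^sub>o\<^bsub>?S\<^esub> \<beta> ` component ?S \<alpha>"
      proof
        fix U assume "U \<in> component ?S (\<beta> \<otimes>\<^bsub>G\<^esub> \<alpha> \<otimes>\<^bsub>G\<^esub> inv\<^bsub>G\<^esub> \<beta>)"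
        then have "\<phi>\<^sub>o (inv\<^bsub>G\<^esub> \<beta>) U \<in> component ?S \<alpha>" "U = \<phi>\<^sub>o \<beta> (\<phi>\<^sub>o (inv\<^bsub>G\<^esub> \<beta>) U)"
          using Act[of "inv\<^bsub>G\<^esub> \<beta>" U] by (simp_all add: component_def)
        then show "U \<in> \<phi>\<^sub>o\<^bsub>?S\<^esub> \<beta> ` component ?S \<alpha>" by simp
      qed
    qed
  qed simp_all
  interpret S: braided_t_category G ?S
  proof
    show "Braid ?S U V \<in> Hom ?S (U \<otimes>\<^sub>o\<^bsub>?S\<^esub> V) (\<phi>\<^sub>o\<^bsub>?S\<^esub> (Deg ?S U) V \<otimes>\<^sub>o\<^bsub>?S\<^esub> U)"
      if "U \<in> Obj ?S" "V \<in> Obj ?S" for U V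
      using that tens Act Braid_Hom[of U V] by (simp add: Hom_full_sub)
    show "iso_arr ?S (Braid ?S U V)" if "U \<in> Obj ?S" "V \<in> Obj ?S" for U V
      using that tens Act iso_arr_full_sub[of "Braid T U V" X] by simp
    show "(\<phi>\<^sub>a\<^bsub>?S\<^esub> (Deg ?S U) g \<otimes>\<^sub>a\<^bsub>?S\<^esub> f) \<cdot>\<^bsub>?S\<^esub> Braid ?S U V = Braid ?S U' V' \<cdot>\<^bsub>?S\<^esub> (f \<otimes>\<^sub>a\<^bsub>?S\<^esub> g)"
      if "f \<in> Hom ?S U U'" "g \<in> Hom ?S V V'" for f g U U' V V'
      using that Braid_natural[of f U U' g V V'] by (simp add: Hom_full_sub)
  qed (simp_all add: Braid_TensO_left Braid_TensO_right)
  show ?thesis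
  proof
    show "Twist ?S U \<in> Hom ?S U (\<phi>\<^sub>o\<^bsub>?S\<^esub> (Deg ?S U) U)" if "U \<in> Obj ?S" for U
      using that Act Twist_Hom[of U] by (simp add: Hom_full_sub)
    show "iso_arr ?S (Twist ?S U)" if "U \<in> Obj ?S" for U
      using that Act iso_arr_full_sub[of "Twist T U" X] by simp
    show "Twist ?S V \<cdot>\<^bsub>?S\<^esub> f = \<phi>\<^sub>a\<^bsub>?S\<^esub> (Deg ?S U) f \<cdot>\<^bsub>?S\<^esub> Twist ?S U"
      if "f \<in> Hom ?S U V" for f U V
      using that Twist_natural[of f U V] by (simp add: Hom_full_sub)
  qed (simp_all add: Twist_TensO)
qed

end

section \<open>Stability and orbits under the group\<close>

context t_category
begin

text \<open>The action of \<beta> conjugates degrees by \<beta>, so an element that fixes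
  \<open>U\<close> commutes with its degree.\<close>

lemma stable_left_dual_iff:
  "stable_left_dual G T U U' b d \<longleftrightarrow> left_dual T U U' b d \<and>
    (\<forall>\<beta> \<in> carrier G. \<phi>\<^sub>o \<beta> U = U \<longrightarrow> \<phi>\<^sub>a \<beta> b = b \<and> \<phi>\<^sub>a \<beta> d = d)"
proof -
  have "\<beta> \<otimes>\<^bsub>G\<^esub> Deg T U = Deg T U \<otimes>\<^bsub>G\<^esub> \<beta>" if "U \<in> Obj T" "\<beta> \<in> carrier G" "\<phi>\<^sub>o \<beta> U = U" for \<beta>
  proof -
    have "Deg T U = \<beta> \<otimes>\<^bsub>G\<^esub> (Deg T U \<otimes>\<^bsub>G\<^esub> inv\<^bsub>G\<^esub> \<beta>)"
      using Deg_ActO[of \<beta> U] that by simp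
    then have "Deg T U \<otimes>\<^bsub>G\<^esub> \<beta> = \<beta> \<otimes>\<^bsub>G\<^esub> (Deg T U \<otimes>\<^bsub>G\<^esub> inv\<^bsub>G\<^esub> \<beta>) \<otimes>\<^bsub>G\<^esub> \<beta>"
      by (rule arg_cong)
    then show ?thesis using that by simp
  qed
  then show ?thesis by (auto simp: stable_left_dual_def left_dual_def)
qed

text \<open>The inverse of \<gamma> times \<beta> fixes \<open>U\<close>, so stability applies to
  it. This makes a conjugated unit or counit depend on the conjugated object alone.\<close>

lemma stable_left_dual_Act_cong:
  assumes stable: "stable_left_dual G T U U' b d"
    and [simp]: "\<beta> \<in> carrier G" "\<gamma> \<in> carrier G" and eq: "\<phi>\<^sub>o \<beta> U = \<phi>\<^sub>o \<gamma> U"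
  shows "\<phi>\<^sub>a \<beta> b = \<phi>\<^sub>a \<gamma> b" "\<phi>\<^sub>a \<beta> d = \<phi>\<^sub>a \<gamma> d"
proof -
  have [simp]: "U \<in> Obj T" "b \<in> Arr T" "d \<in> Arr T"
    using stable by (simp_all add: stable_left_dual_def left_dual_def Hom_def)
  have "\<phi>\<^sub>o (inv\<^bsub>G\<^esub> \<gamma> \<otimes>\<^bsub>G\<^esub> \<beta>) U = \<phi>\<^sub>o (inv\<^bsub>G\<^esub> \<gamma>) (\<phi>\<^sub>o \<beta> U)" by simp
  also have "\<dots> = U" unfolding eq by simp
  finally have "\<phi>\<^sub>a (inv\<^bsub>G\<^esub> \<gamma> \<otimes>\<^bsub>G\<^esub> \<beta>) b = b" "\<phi>\<^sub>a (inv\<^bsub>G\<^esub> \<gamma> \<otimes>\<^bsub>G\<^esub> \<beta>) d = d"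
    using stable by (simp_all add: stable_left_dual_iff)
  then have "\<phi>\<^sub>a \<gamma> (\<phi>\<^sub>a (inv\<^bsub>G\<^esub> \<gamma> \<otimes>\<^bsub>G\<^esub> \<beta>) b) = \<phi>\<^sub>a \<gamma> b" "\<phi>\<^sub>a \<gamma> (\<phi>\<^sub>a (inv\<^bsub>G\<^esub> \<gamma> \<otimes>\<^bsub>G\<^esub> \<beta>) d) = \<phi>\<^sub>a \<gamma> d"
    by simp_all
  then show "\<phi>\<^sub>a \<beta> b = \<phi>\<^sub>a \<gamma> b" "\<phi>\<^sub>a \<beta> d = \<phi>\<^sub>a \<gamma> d" by simp_all
qed

lemma orbit_eq:
  assumes U: "U \<in> Obj T" and V: "V \<in> orbit G T U"
  shows "orbit G T V = orbit G T U"
proof -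
  obtain \<beta> where \<beta>: "\<beta> \<in> carrier G" "V = \<phi>\<^sub>o \<beta> U" using V by (auto simp: orbit_def)
  have "\<phi>\<^sub>o \<gamma> V = \<phi>\<^sub>o (\<gamma> \<otimes>\<^bsub>G\<^esub> \<beta>) U" if "\<gamma> \<in> carrier G" for \<gamma> using that \<beta> U by simp
  moreover have "\<phi>\<^sub>o \<gamma> U = \<phi>\<^sub>o (\<gamma> \<otimes>\<^bsub>G\<^esub> inv\<^bsub>G\<^esub> \<beta>) V" if "\<gamma> \<in> carrier G" for \<gamma>
    using that \<beta> U by simp
  ultimately show ?thesis
    unfolding orbit_def using m_closed[OF _ \<beta>(1)] m_closed[OF _ inv_closed[OF \<beta>(1)]] by blast
qed

lemma orbit_refl: "U \<in> Obj T \<Longrightarrow> U \<in> orbit G T U"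
  unfolding orbit_def using Act_one(1)[of U] one_closed by force

end

context balanced_t_category
begin

text \<open>If \<gamma> fixes the conjugate of \<open>U\<close> by \<beta>, then \<gamma>\<beta> and
  \<beta> have the same effect on \<open>U\<close>, hence on \<open>b\<close> and
  \<open>d\<close>.\<close>

lemma good_left_dual_Act:
  assumes good: "good_left_dual G T U U' b d" and \<beta> [simp]: "\<beta> \<in> carrier G"
  shows "good_left_dual G T (\<phi>\<^sub>o \<beta> U) (\<phi>\<^sub>o \<beta> U') (\<phi>\<^sub>a \<beta> b) (\<phi>\<^sub>a \<beta> d)"
proof -
  have stable: "stable_left_dual G T U U' b d" and rd: "ribbon_dual G T U U' b d"
    using good by (simp_all add: good_left_dual_iff)
  note [simp] = ribbon_dualD(2-10)[OF rd]
  have "\<phi>\<^sub>a \<gamma> (\<phi>\<^sub>a \<beta> b) = \<phi>\<^sub>a \<beta> b" "\<phi>\<^sub>a \<gamma> (\<phi>\<^sub>a \<beta> d) = \<phi>\<^sub>a \<beta> d"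
    if "\<gamma> \<in> carrier G" "\<phi>\<^sub>o \<gamma> (\<phi>\<^sub>o \<beta> U) = \<phi>\<^sub>o \<beta> U" for \<gamma>
    using stable_left_dual_Act_cong[OF stable, of "\<gamma> \<otimes>\<^bsub>G\<^esub> \<beta>" \<beta>] that by simp_all
  then have "stable_left_dual G T (\<phi>\<^sub>o \<beta> U) (\<phi>\<^sub>o \<beta> U') (\<phi>\<^sub>a \<beta> b) (\<phi>\<^sub>a \<beta> d)"
    using left_dual_Act[OF ribbon_dualD(1)[OF rd] \<beta>] by (simp add: stable_left_dual_iff)
  then show ?thesis
    using ribbon_dual_Act[OF rd \<beta>] by (simp add: good_left_dual_iff)
qed

lemma N_Obj_subset: "N_Obj G T \<subseteq> Obj T"
  by (auto simp: N_Obj_def)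

lemma N_ObjI: "good_left_dual G T U U' b d \<Longrightarrow> U \<in> N_Obj G T"
  by (auto simp: N_Obj_def good_left_dual_iff ribbon_dual_def left_dual_def)

lemma N_Obj_Act: "U \<in> N_Obj G T \<Longrightarrow> \<beta> \<in> carrier G \<Longrightarrow> \<phi>\<^sub>o \<beta> U \<in> N_Obj G T"
  unfolding N_Obj_def using good_left_dual_Act by simp blast

lemma N_Obj_TensO:
  assumes stable: "stable_duals_TensO G T" and UV: "U \<in> N_Obj G T" "V \<in> N_Obj G T"
  shows "U \<otimes>\<^sub>o V \<in> N_Obj G T"
proof -
  obtain U' b d V' e f where "ribbon_dual G T U U' b d" "ribbon_dual G T V V' e f"
    using UV by (auto simp: N_Obj_def good_left_dual_iff)
  moreover obtain W g h where "stable_left_dual G T (U \<otimes>\<^sub>o V) W g h"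
    using stable UV unfolding stable_duals_TensO_def by blast
  ultimately show ?thesis
    using ribbon_dual_TensO N_ObjI good_left_dual_iff stable_left_dual_def by metis
qed

lemma N_Obj_dual:
  assumes stable: "stable_duals_Star G T" and good: "good_left_dual G T U U' b d"
  shows "U' \<in> N_Obj G T"
proof -
  obtain W g h where "stable_left_dual G T U' W g h"
    using stable good unfolding stable_duals_Star_def by blast
  then show ?thesis
    using good ribbon_dual_Star N_ObjI good_left_dual_iff stable_left_dual_def by metis
qed

lemma balanced_N_cat: "stable_duals_TensO G T \<Longrightarrow> balanced_t_category G (N_cat G T)"
  unfolding N_cat_def
  using balanced_full_sub[OF N_Obj_subset N_ObjI[OF good_left_dual_TUnit]] N_Obj_TensO N_Obj_Act
  by blast

text \<open>The family records some group element for each object of an orbit, and the elements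
  recorded for \<open>V\<close> and for its conjugate by \<gamma> need not differ by \<gamma>. They
  lead to the same object, however, and stability at the fixed representative makes the units and
  counits agree.\<close>

lemma chosen_good_dualsD:
  assumes D: "chosen_good_duals G T D" and V: "V \<in> N_Obj G T"
  shows "good_left_dual G T V (Star D V) (Coev D V) (Ev D V)"
    "\<gamma> \<in> carrier G \<Longrightarrow> \<phi>\<^sub>a \<gamma> (Coev D V) = Coev D (\<phi>\<^sub>o \<gamma> V)"
    "\<gamma> \<in> carrier G \<Longrightarrow> \<phi>\<^sub>a \<gamma> (Ev D V) = Ev D (\<phi>\<^sub>o \<gamma> V)"
proof -
  obtain R where R: "R \<subseteq> N_Obj G T"
    "\<forall>U \<in> N_Obj G T. \<exists>!U\<^sub>0. U\<^sub>0 \<in> R \<and> U\<^sub>0 \<in> orbit G T U"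
    "\<forall>U \<in> R. good_left_dual G T U (Star D U) (Coev D U) (Ev D U)"
    and conj: "\<forall>U \<in> R. \<forall>W \<in> orbit G T U. \<exists>\<beta> \<in> carrier G. W = \<phi>\<^sub>o \<beta> U \<and>
        Star D W = \<phi>\<^sub>o \<beta> (Star D U) \<and> Coev D W = \<phi>\<^sub>a \<beta> (Coev D U) \<and> Ev D W = \<phi>\<^sub>a \<beta> (Ev D U)"
    using D unfolding chosen_good_duals_def by (elim exE conjE) (rule that)
  have VO: "V \<in> Obj T" using V N_Obj_subset by blast
  obtain U where U: "U \<in> R" "U \<in> orbit G T V" using bspec[OF R(2) V] by blast
  then have UO: "U \<in> Obj T" using R(1) N_Obj_subset by blast
  have orb: "orbit G T U = orbit G T V" by (rule orbit_eq[OF VO U(2)])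
  have good: "good_left_dual G T U (Star D U) (Coev D U) (Ev D U)" by (rule bspec[OF R(3) U(1)])
  then have stable: "stable_left_dual G T U (Star D U) (Coev D U) (Ev D U)"
    by (simp add: good_left_dual_iff)
  then have [simp]: "Coev D U \<in> Arr T" "Ev D U \<in> Arr T"
    by (simp_all add: stable_left_dual_def left_dual_def Hom_def)
  obtain \<beta> where \<beta>: "\<beta> \<in> carrier G" "V = \<phi>\<^sub>o \<beta> U" "Star D V = \<phi>\<^sub>o \<beta> (Star D U)"
    "Coev D V = \<phi>\<^sub>a \<beta> (Coev D U)" "Ev D V = \<phi>\<^sub>a \<beta> (Ev D U)"
    using bspec[OF bspec[OF conj U(1)], of V] orbit_refl[OF VO] orb by blast
  show "good_left_dual G T V (Star D V) (Coev D V) (Ev D V)"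
    using good_left_dual_Act[OF good \<beta>(1)] unfolding \<beta>(3-5) by (simp add: \<beta>(2))
  assume \<gamma>: "\<gamma> \<in> carrier G"
  then have "\<phi>\<^sub>o \<gamma> V \<in> orbit G T U"
    unfolding orb by (auto simp: orbit_def)
  then obtain \<delta> where \<delta>: "\<delta> \<in> carrier G" "\<phi>\<^sub>o \<gamma> V = \<phi>\<^sub>o \<delta> U"
    "Coev D (\<phi>\<^sub>o \<gamma> V) = \<phi>\<^sub>a \<delta> (Coev D U)" "Ev D (\<phi>\<^sub>o \<gamma> V) = \<phi>\<^sub>a \<delta> (Ev D U)"
    using bspec[OF bspec[OF conj U(1)]] by blast
  have eq: "\<phi>\<^sub>o (\<gamma> \<otimes>\<^bsub>G\<^esub> \<beta>) U = \<phi>\<^sub>o \<delta> U"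
    using \<delta>(2) \<beta>(1,2) \<gamma> UO by simp
  show "\<phi>\<^sub>a \<gamma> (Coev D V) = Coev D (\<phi>\<^sub>o \<gamma> V)" "\<phi>\<^sub>a \<gamma> (Ev D V) = Ev D (\<phi>\<^sub>o \<gamma> V)"
    unfolding \<delta>(3,4) \<beta>(4,5)
    using stable_left_dual_Act_cong[OF stable _ \<delta>(1) eq] \<beta>(1) \<gamma> by simp_all
qed

section \<open>The ribbon structure, the existence of a choice, and maximality\<close>

lemma left_dual_full_sub:
  assumes "left_dual T U U' b d" "U \<in> X" "U' \<in> X" "\<I> \<in> X" "U \<otimes>\<^sub>o U' \<in> X" "U' \<otimes>\<^sub>o U \<in> X"
  shows "left_dual (full_sub T X) U U' b d"
  using assms unfolding left_dual_def by (simp add: Hom_full_sub)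

lemma ribbon_N_cat:
  assumes tens: "stable_duals_TensO G T" and star: "stable_duals_Star G T"
    and D: "chosen_good_duals G T D"
  shows "ribbon_t_category G (N_cat G T) D"
proof -
  let ?S = "N_cat G T"
  interpret S: balanced_t_category G ?S by (rule balanced_N_cat[OF tens])
  have N: "Obj ?S = N_Obj G T" by (simp add: N_cat_def)
  show ?thesis
  proof
    fix U assume "U \<in> Obj ?S"
    then have U: "U \<in> N_Obj G T" by (simp add: N)
    have good: "good_left_dual G T U (Star D U) (Coev D U) (Ev D U)"
      by (rule chosen_good_dualsD(1)[OF D U])
    then have rd: "ribbon_dual G T U (Star D U) (Coev D U) (Ev D U)"
      by (simp add: good_left_dual_iff)
    have U': "Star D U \<in> N_Obj G T" by (rule N_Obj_dual[OF star good])
    show "left_dual ?S U (Star D U) (Coev D U) (Ev D U)"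
      unfolding N_cat_def
      by (rule left_dual_full_sub[OF ribbon_dualD(1)[OF rd] U U' N_ObjI[OF good_left_dual_TUnit]
            N_Obj_TensO[OF tens U U'] N_Obj_TensO[OF tens U' U]])
    show "Deg ?S (Star D U) = inv\<^bsub>G\<^esub> Deg ?S U"
      using ribbon_dualD(10)[OF rd] by (simp add: N_cat_def)
    show "\<phi>\<^sub>a\<^bsub>?S\<^esub> \<beta> (Coev D U) = Coev D (\<phi>\<^sub>o\<^bsub>?S\<^esub> \<beta> U)" "\<phi>\<^sub>a\<^bsub>?S\<^esub> \<beta> (Ev D U) = Ev D (\<phi>\<^sub>o\<^bsub>?S\<^esub> \<beta> U)"
      if "\<beta> \<in> carrier G" for \<beta>
      using chosen_good_dualsD(2,3)[OF D U that] by (simp_all add: N_cat_def)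
    show "(\<iota>\<^bsub>?S\<^esub> (\<phi>\<^sub>o\<^bsub>?S\<^esub> (Deg ?S U) U) \<otimes>\<^sub>a\<^bsub>?S\<^esub> Twist ?S (\<phi>\<^sub>o\<^bsub>?S\<^esub> (Deg ?S U) (Star D U))) \<cdot>\<^bsub>?S\<^esub>
        Coev D (\<phi>\<^sub>o\<^bsub>?S\<^esub> (Deg ?S U) U) =
      (Twist ?S U \<otimes>\<^sub>a\<^bsub>?S\<^esub> \<iota>\<^bsub>?S\<^esub> (Star D U)) \<cdot>\<^bsub>?S\<^esub> Coev D U"
      \<comment> \<open>\<open>ribbon_dual\<close> contains the conjugate of the unit, the ribbon
        axiom the unit of the conjugate; equivariance of the family identifies them.\<close>
      using ribbon_dualD(13)[OF rd] chosen_good_dualsD(2)[OF D U, of "Deg T U"] ribbon_dualD(2)[OF rd]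
      by (simp add: N_cat_def)
  qed
qed

lemma chosen_good_duals_exist: "\<exists>D. chosen_good_duals G T D"
proof -
  let ?N = "N_Obj G T"
  \<comment> \<open>The set chosen from depends on \<open>U\<close> only through its orbit, so
    \<open>rep\<close> is constant on orbits.\<close>
  define rep where "rep U = (SOME V. V \<in> ?N \<inter> orbit G T U)" for U
  have rep: "rep U \<in> ?N" "rep U \<in> orbit G T U" if "U \<in> ?N" for U
  proof -
    have "U \<in> ?N \<inter> orbit G T U" using that N_Obj_subset orbit_refl by blast
    then have "rep U \<in> ?N \<inter> orbit G T U" unfolding rep_def by (rule someI)
    then show "rep U \<in> ?N" "rep U \<in> orbit G T U" by simp_all
  qed
  have rep_eq: "orbit G T (rep U) = orbit G T U" if "U \<in> ?N" for U
    using orbit_eq rep(2)[OF that] that N_Obj_subset by blast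
  have rep_cong: "rep U = rep V" if "orbit G T U = orbit G T V" for U V
    using that by (simp add: rep_def)
  have "\<exists>\<beta>. \<beta> \<in> carrier G \<and> U = \<phi>\<^sub>o \<beta> (rep U)" if U: "U \<in> ?N" for U
  proof -
    have "U \<in> orbit G T (rep U)"
      unfolding rep_eq[OF U] using orbit_refl U N_Obj_subset by blast
    then show ?thesis by (auto simp: orbit_def)
  qed
  then obtain \<beta> where \<beta>': "\<forall>U \<in> ?N. \<beta> U \<in> carrier G \<and> U = \<phi>\<^sub>o (\<beta> U) (rep U)"
    using bchoice[of ?N "\<lambda>U \<beta>. \<beta> \<in> carrier G \<and> U = \<phi>\<^sub>o \<beta> (rep U)"] by blast
  have \<beta>: "\<beta> U \<in> carrier G" "U = \<phi>\<^sub>o (\<beta> U) (rep U)" if "U \<in> ?N" for U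
    using bspec[OF \<beta>' that] by simp_all
  have "\<forall>U \<in> ?N. \<exists>q. good_left_dual G T U (fst q) (fst (snd q)) (snd (snd q))"
    by (auto simp: N_Obj_def)
  from bchoice[OF this] obtain q where
    q: "\<forall>U \<in> ?N. good_left_dual G T U (fst (q U)) (fst (snd (q U))) (snd (snd (q U)))" ..
  define st co ev where "st U = fst (q U)" and "co U = fst (snd (q U))" and "ev U = snd (snd (q U))" for U
  have good: "good_left_dual G T U (st U) (co U) (ev U)" if "U \<in> ?N" for U
    unfolding st_def co_def ev_def by (rule bspec[OF q that])
  define D where "D = \<lparr>Star = \<lambda>U. \<phi>\<^sub>o (\<beta> U) (st (rep U)), Coev = \<lambda>U. \<phi>\<^sub>a (\<beta> U) (co (rep U)),
    Ev = \<lambda>U. \<phi>\<^sub>a (\<beta> U) (ev (rep U))\<rparr>"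
  have "chosen_good_duals G T D"
    unfolding chosen_good_duals_def
  proof (intro exI[of _ "rep ` ?N"] conjI ballI)
    show "rep ` ?N \<subseteq> ?N" using rep(1) by blast
  next
    fix U assume U: "U \<in> ?N"
    show "\<exists>!U\<^sub>0. U\<^sub>0 \<in> rep ` ?N \<and> U\<^sub>0 \<in> orbit G T U"
    proof (rule ex1I[of _ "rep U"])
      show "rep U \<in> rep ` ?N \<and> rep U \<in> orbit G T U" using U rep by blast
    next
      fix V assume "V \<in> rep ` ?N \<and> V \<in> orbit G T U"
      then obtain W where W: "W \<in> ?N" "V = rep W" "V \<in> orbit G T U" by blast
      have "orbit G T W = orbit G T V" using rep_eq[OF W(1)] W(2) by simp
      also have "\<dots> = orbit G T U" using orbit_eq[OF _ W(3)] U N_Obj_subset by blast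
      finally show "V = rep U" unfolding W(2) by (rule rep_cong)
    qed
  next
    fix U assume "U \<in> rep ` ?N"
    then have U: "U \<in> ?N" using rep(1) by blast
    show "good_left_dual G T U (Star D U) (Coev D U) (Ev D U)"
      using good_left_dual_Act[OF good[OF rep(1)[OF U]] \<beta>(1)[OF U]] \<beta>(2)[OF U] by (simp add: D_def)
  next
    fix U V assume "U \<in> rep ` ?N" and V: "V \<in> orbit G T U"
    then obtain W where W: "W \<in> ?N" "U = rep W" by blast
    have U: "U \<in> ?N" using rep(1) W by blast
    then have UO: "U \<in> Obj T" using N_Obj_subset by blast
    have VN: "V \<in> ?N" using V N_Obj_Act[OF U] by (auto simp: orbit_def)
    have rU: "rep U = U" using rep_cong rep_eq[OF W(1)] W(2) by blast
    have rV: "rep V = U" using rep_cong[OF orbit_eq[OF UO V]] rU by simp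
    have rd: "ribbon_dual G T U (st U) (co U) (ev U)"
      using good[OF U] by (simp add: good_left_dual_iff)
    note [simp] = ribbon_dualD(2-9)[OF rd] \<beta>(1)[OF U] \<beta>(1)[OF VN]
    have bU: "\<phi>\<^sub>o (\<beta> U) U = U" using \<beta>(2)[OF U] rU by simp
    have bV: "V = \<phi>\<^sub>o (\<beta> V) U" using \<beta>(2)[OF VN] rV by simp
    have iU: "\<phi>\<^sub>o (inv\<^bsub>G\<^esub> \<beta> U) U = U"
    proof -
      have "\<phi>\<^sub>o (inv\<^bsub>G\<^esub> \<beta> U) (\<phi>\<^sub>o (\<beta> U) U) = U" by simp
      then show ?thesis unfolding bU .
    qed
    show "\<exists>\<gamma> \<in> carrier G. V = \<phi>\<^sub>o \<gamma> U \<and> Star D V = \<phi>\<^sub>o \<gamma> (Star D U) \<and>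
        Coev D V = \<phi>\<^sub>a \<gamma> (Coev D U) \<and> Ev D V = \<phi>\<^sub>a \<gamma> (Ev D U)"
    \<comment> \<open>\<open>\<beta> U\<close> fixes the representative \<open>U\<close> but need
      not be 1, so \<open>D\<close> at \<open>U\<close> is already conjugated by it; the inverse
      factor removes this conjugation before \<open>\<beta> V\<close> is applied.\<close>
    proof (rule bexI[of _ "\<beta> V \<otimes>\<^bsub>G\<^esub> inv\<^bsub>G\<^esub> \<beta> U"])
      have "V = \<phi>\<^sub>o (\<beta> V) (\<phi>\<^sub>o (inv\<^bsub>G\<^esub> \<beta> U) U)" unfolding iU by (rule bV)
      then show "V = \<phi>\<^sub>o (\<beta> V \<otimes>\<^bsub>G\<^esub> inv\<^bsub>G\<^esub> \<beta> U) U \<and>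
          Star D V = \<phi>\<^sub>o (\<beta> V \<otimes>\<^bsub>G\<^esub> inv\<^bsub>G\<^esub> \<beta> U) (Star D U) \<and>
          Coev D V = \<phi>\<^sub>a (\<beta> V \<otimes>\<^bsub>G\<^esub> inv\<^bsub>G\<^esub> \<beta> U) (Coev D U) \<and>
          Ev D V = \<phi>\<^sub>a (\<beta> V \<otimes>\<^bsub>G\<^esub> inv\<^bsub>G\<^esub> \<beta> U) (Ev D U)"
        by (simp add: D_def rU rV)
    qed simp
  qed
  then show ?thesis by blast
qed

text \<open>The units and counits of an autonomous T-category are equivariant: an element fixing
  \<open>U\<close> fixes them, which is stability. The triangle identities and the ribbon equation
  concern the same arrows in \<open>T\<close>. The subcategory may fail to be full, but its arrows
  lie in the full subcategory on the larger class of objects.\<close>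

lemma ribbon_subcategory_N_cat:
  assumes X: "X \<subseteq> Obj T" and A: "A \<subseteq> Arr T"
    and rib: "ribbon_t_category G (T\<lparr>Obj := X, Arr := A\<rparr>) D"
  shows "X \<subseteq> Obj (N_cat G T)" "A \<subseteq> Arr (N_cat G T)"
proof -
  let ?S = "T\<lparr>Obj := X, Arr := A\<rparr>"
  interpret S: ribbon_t_category G ?S D by (rule rib)
  show XN: "X \<subseteq> Obj (N_cat G T)"
  proof
    fix U assume U: "U \<in> X"
    have "left_dual ?S U (Star D U) (Coev D U) (Ev D U)" using S.left_dual_Star[of U] U by simp
    then have dual: "left_dual T U (Star D U) (Coev D U) (Ev D U)"
      using X A by (auto simp: left_dual_def Hom_def)
    have Act: "\<phi>\<^sub>a \<beta> (Coev D U) = Coev D (\<phi>\<^sub>o \<beta> U)" "\<phi>\<^sub>a \<beta> (Ev D U) = Ev D (\<phi>\<^sub>o \<beta> U)"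
      if "\<beta> \<in> carrier G" for \<beta>
      using S.Coev_Act[OF that, of U] S.Ev_Act[OF that, of U] U by simp_all
    have "stable_left_dual G T U (Star D U) (Coev D U) (Ev D U)"
      using dual Act by (simp add: stable_left_dual_iff)
    moreover have "ribbon_dual G T U (Star D U) (Coev D U) (Ev D U)"
      using dual S.ribbon[of U] U X Act[of "Deg T U"] by (auto simp: ribbon_dual_def)
    ultimately have "U \<in> N_Obj G T"
      by (intro N_ObjI) (simp add: good_left_dual_iff)
    then show "U \<in> Obj (N_cat G T)" by (simp add: N_cat_def)
  qed
  show "A \<subseteq> Arr (N_cat G T)"
  proof
    fix f assume f: "f \<in> A"
    then have "Dom T f \<in> X" "Cod T f \<in> X" using S.Dom_Obj[of f] S.Cod_Obj[of f] by simp_all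
    with f A XN show "f \<in> Arr (N_cat G T)" by (auto simp: N_cat_def)
  qed
qed

end

theorem mainTheorem8:
  fixes G :: "('g, 'n) monoid_scheme"
    and T :: "('g, 'o, 'a, 'm) balanced_t_cat_scheme"
  assumes "group G"
    and "balanced_t_category G T"
  shows
    "(stable_duals_TensO G T \<longrightarrow> balanced_t_category G (N_cat G T)) \<and>
     (\<exists>D. chosen_good_duals G T D) \<and>
     (stable_duals_TensO G T \<and> stable_duals_Star G T \<longrightarrow>
       (\<forall>D. chosen_good_duals G T D \<longrightarrow> ribbon_t_category G (N_cat G T) D)) \<and>
     (\<forall>X A (D :: ('o, 'a) duals).
       X \<subseteq> Obj T \<and> A \<subseteq> Arr T \<and> ribbon_t_category G (T\<lparr>Obj := X, Arr := A\<rparr>) D \<longrightarrow>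
       X \<subseteq> Obj (N_cat G T) \<and> A \<subseteq> Arr (N_cat G T))"
proof -
  interpret balanced_t_category G T by (rule assms(2))
  show ?thesis
  proof (intro conjI impI allI)
    show "stable_duals_TensO G T \<Longrightarrow> balanced_t_category G (N_cat G T)"
      by (rule balanced_N_cat)
    show "\<exists>D. chosen_good_duals G T D" by (rule chosen_good_duals_exist)
  next
    fix D :: "('o, 'a) duals"
    assume "stable_duals_TensO G T \<and> stable_duals_Star G T" "chosen_good_duals G T D"
    then show "ribbon_t_category G (N_cat G T) D" by (elim conjE) (rule ribbon_N_cat)
  next
    fix X A and D :: "('o, 'a) duals"
    assume "X \<subseteq> Obj T \<and> A \<subseteq> Arr T \<and> ribbon_t_category G (T\<lparr>Obj := X, Arr := A\<rparr>) D"
    then have sub: "X \<subseteq> Obj T" "A \<subseteq> Arr T" "ribbon_t_category G (T\<lparr>Obj := X, Arr := A\<rparr>) D"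
      by simp_all
    show "X \<subseteq> Obj (N_cat G T)" "A \<subseteq> Arr (N_cat G T)"
      by (rule ribbon_subcategory_N_cat[OF sub])+
  qed
qed

end
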